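(* Let $C,D\subset\mathbb{R}^2$ be convex bodies such that $D$ is a convex polygon parallel to $C$. Then there exists a constant $\rho(C,D)>0$, depending only on $C$ and $D$, such that for every $n\ge3$ and every packing $S$ of $n$ positive homothets of $C$ in $D$, $$\mathrm{per}(S)\le\rho(C,D)\,\bigl(\mathrm{per}(D)+\mathrm{esc}(S)\bigr)\,\frac{\log n}{\log\log n}.$$ Moreover, there exists a constant $\sigma(C,D)>0$, depending only on $C$ and $D$, such that for every $n\ge3$ there exists a packing $S$ of $n$ positive homothets of $C$ in $D$ with $$\mathrm{per}(S)\ge\sigma(C,D)\,\bigl(\mathrm{per}(D)+\mathrm{esc}(S)\bigr)\,\frac{\log n}{\log\log n}.$$
   Context: A convex body is a compact convex subset of $\mathbb{R}^2$ with nonempty interior. A positive homothet of $C$ is a set of the form $\mu C + v$ with $\mu>0$ and $v\in\mathbb{R}^2$. A finite set $S=\{C_1,\dots,C_n\}$ of convex bodies is a packing in a convex body $D$ if all $C_i$ are contained in $D$ and the $C_i$ have pairwise disjoint interiors. $\mathrm{per}(C)$ denotes the perimeter of a convex body $C$, and $\mathrm{per}(S)=\sum_{i=1}^n\mathrm{per}(C_i)$. For a convex body $K\subset D$, the escape distance $\mathrm{esc}(K)$ is the (minimum Euclidean) distance between $K$ and the boundary $\partial D$ of $D$; for a packing $S=\{C_1,\dots,C_n\}$ in $D$, $\mathrm{esc}(S)=\sum_{i=1}^n\mathrm{esc}(C_i)$. $\log$ denotes the logarithm to base 2. Parallel: for a unit direction vector $\mathbf{d}\in\mathbb{S}^1$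 and a convex body $K$, the supporting line $\ell_{\mathbf d}(K)$ is the directed line of direction $\mathbf d$ tangent to $K$ such that the closed halfplane on the left of $\ell_{\mathbf d}(K)$ contains $K$. If $\ell_{\mathbf d}(K)\cap K$ is a nondegenerate line segment, it is called a side of $K$. A convex polygon $D$ is parallel to a convex body $C$ if for every direction $\mathbf d\in\mathbb{S}^1$, whenever $\ell_{\mathbf d}(D)\cap D$ is a side of $D$, then $\ell_{\mathbf d}(C)\cap C$ is also a side of $C$. *)

theory Defs
  imports "HOL-Analysis.Analysis"
begin

type_synonym plane = "real ^ 2"

definition convex_body :: "plane set \<Rightarrow> bool" where
  "convex_body K \<longleftrightarrow> compact K \<and> convex K \<and> interior K \<noteq> {}"

definition positive_homothet :: "plane set \<Rightarrow> plane set \<Rightarrow> bool" where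
  "positive_homothet C K \<longleftrightarrow> (\<exists>\<mu> v. \<mu> > 0 \<and> K = (\<lambda>x. \<mu> *\<^sub>R x + v) ` C)"

(* Bodies with disjoint nonempty interiors are distinct, so a packing of n bodies
   is a set of cardinality n. *)
definition packing :: "plane set set \<Rightarrow> plane set \<Rightarrow> bool" where
  "packing S D \<longleftrightarrow> finite S \<and> (\<forall>K\<in>S. convex_body K \<and> K \<subseteq> D) \<and>
     pairwise (\<lambda>K L. interior K \<inter> interior L = {}) S"

(* Arc length: supremum over the partitions of [0,1], given as sorted lists. *)
definition curve_length :: "(real \<Rightarrow> plane) \<Rightarrow> ennreal" where
  "curve_length g =
     (SUP ts \<in> {ts. sorted ts \<and> set ts \<subseteq> {0..1}}.
        ennreal (\<Sum>i<length ts - 1. dist (g (ts ! i)) (g (ts ! Suc i))))"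

(* The length of the boundary curve. All simple closed parametrizations of the boundary of
   a convex body have the same, finite length; the infimum picks out this common value. *)
definition perimeter :: "plane set \<Rightarrow> real" where
  "perimeter K = enn2real
     (INF g \<in> {g. simple_path g \<and> pathfinish g = pathstart g \<and> path_image g = frontier K}.
        curve_length g)"

definition esc :: "plane set \<Rightarrow> plane set \<Rightarrow> real" where
  "esc D K = setdist K (frontier D)"

(* The direction d turned by 90 degrees counterclockwise: the closed halfplane on the left of
   the directed line through p of direction d is the set of x with 0 \<le> left_normal d \<bullet> (x - p). *)
definition left_normal :: "plane \<Rightarrow> plane" where
  "left_normal d = vector [- d $ 2, d $ 1]"

(* All points p satisfying the condition yield the same line. *)
definition supporting_line :: "plane \<Rightarrow> plane set \<Rightarrow> plane set" where
  "supporting_line d K =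
     {p + t *\<^sub>R d | p t. p \<in> K \<and> (\<forall>x\<in>K. 0 \<le> left_normal d \<bullet> (x - p))}"

definition has_side :: "plane \<Rightarrow> plane set \<Rightarrow> bool" where
  "has_side d K \<longleftrightarrow>
     (\<exists>a b. a \<noteq> b \<and> supporting_line d K \<inter> K = closed_segment a b)"

definition parallel_to :: "plane set \<Rightarrow> plane set \<Rightarrow> bool" where
  "parallel_to D C \<longleftrightarrow> (\<forall>d. norm d = 1 \<longrightarrow> has_side d D \<longrightarrow> has_side d C)"

end

theory Submission
  imports Defs
begin

text \<open>
  Write \<open>y = log n\<close> and \<open>L = y / log y\<close>, and let \<open>\<mu>\<close> be the scale of a homothet of \<open>C\<close>.

  Upper bound. A homothet with escape distance at least a constant multiple of \<open>\<mu> / sqrt y\<close> is paid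
  for by its escape distance, since \<open>sqrt y = O(L)\<close>; homothets of scale below \<open>M / n\<close>, where \<open>M\<close> is
  the largest possible scale, have bounded total. Any other homothet is close to some side of \<open>D\<close>,
  and because \<open>C\<close> has a parallel side, it contains a rectangle proportional to \<open>\<mu>\<close> standing on its
  own side. If two such rectangles overlap in the direction of the side of \<open>D\<close>, one homothet lies
  between the side and the other, so their scales differ by a factor of more than \<open>sqrt y\<close>. Hence the
  scales between \<open>M / n\<close> and \<open>M\<close> fall into \<open>O(log n / log (sqrt y)) = O(L)\<close> classes, in each of which
  the projections to the side are disjoint and have bounded total length.

  Lower bound. Over a side of \<open>D\<close> stack rows of bounding boxes of homothets, with \<open>A ^ j\<close> boxes of side
  \<open>1 / A ^ j\<close> (up to constants) in row \<open>j < k\<close>, where \<open>A\<close> is about \<open>y\<close> and \<open>k\<close> is about \<open>L\<close>. Each row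
  has constant total perimeter and total distance \<open>O(1 / A)\<close> from the side, so the perimeter is of
  order \<open>k\<close> while the escape distances sum to \<open>O(k / A) = O(1)\<close>.

  The perimeter of a convex body is positive and finite because radial projection from the unit circle
  is a Lipschitz parametrization of its boundary.
\<close>

subsection \<open>Perimeters of homothets\<close>

lemma homothety_inverse_image:
  fixes K :: "plane set"
  assumes "\<mu> > 0"
  shows "(\<lambda>x. inverse \<mu> *\<^sub>R x + (- inverse \<mu> *\<^sub>R v)) ` (\<lambda>x. \<mu> *\<^sub>R x + v) ` K = K"
  using assms by (simp add: image_image algebra_simps)

lemma homothety_image_conv:
  fixes K :: "plane set"
  shows "(\<lambda>x. \<mu> *\<^sub>R x + v) ` K = (+) v ` (*\<^sub>R) \<mu> ` K"
  by (simp add: image_image algebra_simps)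

lemma interior_homothety:
  fixes K :: "plane set"
  assumes "\<mu> > 0"
  shows "interior ((\<lambda>x. \<mu> *\<^sub>R x + v) ` K) = (\<lambda>x. \<mu> *\<^sub>R x + v) ` interior K"
proof -
  have "interior ((*\<^sub>R) \<mu> ` K) = (*\<^sub>R) \<mu> ` interior K"
    using assms by (intro interior_injective_linear_image) (auto simp: inj_on_def linear_scaleR)
  then show ?thesis
    by (simp add: homothety_image_conv interior_translation)
qed

lemma frontier_homothety:
  fixes K :: "plane set"
  assumes "\<mu> > 0"
  shows "frontier ((\<lambda>x. \<mu> *\<^sub>R x + v) ` K) = (\<lambda>x. \<mu> *\<^sub>R x + v) ` frontier K"
proof -
  have "closure ((\<lambda>x. \<mu> *\<^sub>R x + v) ` K) = (\<lambda>x. \<mu> *\<^sub>R x + v) ` closure K"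
    by (simp add: homothety_image_conv closure_translation closure_scaleR)
  moreover have "inj (\<lambda>x. \<mu> *\<^sub>R x + v)"
    using assms by (auto simp: inj_on_def)
  ultimately show ?thesis
    unfolding frontier_def using interior_homothety[OF assms, of v K]
    by (simp add: image_set_diff)
qed

lemma convex_body_homothety:
  assumes "\<mu> > 0" "convex_body K"
  shows "convex_body ((\<lambda>x. \<mu> *\<^sub>R x + v) ` K)"
  using assms unfolding convex_body_def
  by (simp add: interior_homothety)
     (auto simp: homothety_image_conv intro!: compact_translation compact_scaling convex_translation convex_scaling)

section \<open>Arc length under homotheties\<close>

text \<open>The index set of the infimum in \<open>perimeter\<close>, named so that this infimum can
  be treated in \<open>ennreal\<close>, before \<open>enn2real\<close> sends an infinite value to
  0.\<close>

definition closed_parametrizations :: "plane set \<Rightarrow> (real \<Rightarrow> plane) set" where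
  "closed_parametrizations K =
     {g. simple_path g \<and> pathfinish g = pathstart g \<and> path_image g = frontier K}"

lemma closed_parametrizations_homothety:
  assumes "\<mu> > 0" "g \<in> closed_parametrizations K"
  shows "(\<lambda>t. \<mu> *\<^sub>R g t + v) \<in> closed_parametrizations ((\<lambda>x. \<mu> *\<^sub>R x + v) ` K)"
proof -
  have "path (\<lambda>t. \<mu> *\<^sub>R g t + v)"
    using assms unfolding closed_parametrizations_def simple_path_def path_def
    by (auto intro!: continuous_intros)
  moreover have "path_image (\<lambda>t. \<mu> *\<^sub>R g t + v) = (\<lambda>x. \<mu> *\<^sub>R x + v) ` path_image g"
    by (auto simp: path_image_def)
  ultimately show ?thesis
    using assms unfolding closed_parametrizations_def simple_path_def loop_free_def
    by (auto simp: pathstart_def pathfinish_def frontier_homothety)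
qed

lemma curve_length_homothety_le:
  assumes "\<mu> > 0"
  shows "curve_length (\<lambda>t. \<mu> *\<^sub>R g t + v) \<le> ennreal \<mu> * curve_length g"
  unfolding curve_length_def
proof (rule SUP_least)
  fix ts :: "real list" assume ts: "ts \<in> {ts. sorted ts \<and> set ts \<subseteq> {0..1}}"
  have "dist (\<mu> *\<^sub>R x + v) (\<mu> *\<^sub>R y + v) = \<mu> * dist x y" for x y :: plane
    using assms by (simp add: dist_norm flip: scaleR_diff_right)
  then have "ennreal (\<Sum>i<length ts - 1. dist (\<mu> *\<^sub>R g (ts ! i) + v) (\<mu> *\<^sub>R g (ts ! Suc i) + v))
     = ennreal \<mu> * ennreal (\<Sum>i<length ts - 1. dist (g (ts ! i)) (g (ts ! Suc i)))"
    using assms by (simp add: ennreal_mult' sum_nonneg flip: sum_distrib_left)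
  also have "\<dots> \<le> ennreal \<mu> * (SUP ts \<in> {ts. sorted ts \<and> set ts \<subseteq> {0..1}}.
        ennreal (\<Sum>i<length ts - 1. dist (g (ts ! i)) (g (ts ! Suc i))))"
    using ts by (intro mult_left_mono SUP_upper) auto
  finally show "ennreal (\<Sum>i<length ts - 1. dist (\<mu> *\<^sub>R g (ts ! i) + v) (\<mu> *\<^sub>R g (ts ! Suc i) + v))
     \<le> \<dots>" .
qed

lemma INF_curve_length_homothety_le:
  assumes "\<mu> > 0"
  shows "(INF g \<in> closed_parametrizations ((\<lambda>x. \<mu> *\<^sub>R x + v) ` K). curve_length g)
     \<le> ennreal \<mu> * (INF g \<in> closed_parametrizations K. curve_length g)" (is "?I \<le> _")
proof -
  have inv: "ennreal (inverse \<mu>) * ennreal \<mu> = 1"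
    using assms by (simp flip: ennreal_mult')
  \<comment> \<open>\<open>INF_greatest\<close> needs the bare infimum on the right, so the factor
    \<open>\<mu>\<close> is first moved to the left.\<close>
  have "ennreal (inverse \<mu>) * ?I \<le> (INF g \<in> closed_parametrizations K. curve_length g)"
  proof (rule INF_greatest)
    fix g assume g: "g \<in> closed_parametrizations K"
    have "?I \<le> ennreal \<mu> * curve_length g"
      using closed_parametrizations_homothety[OF assms g, of v]
        curve_length_homothety_le[OF assms, of g v]
      by (rule INF_lower2[where f = curve_length])
    then have "ennreal (inverse \<mu>) * ?I \<le> ennreal (inverse \<mu>) * (ennreal \<mu> * curve_length g)"
      by (intro mult_left_mono) auto
    then show "ennreal (inverse \<mu>) * ?I \<le> curve_length g"
      by (simp add: inv flip: mult.assoc)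
  qed
  then have "ennreal \<mu> * (ennreal (inverse \<mu>) * ?I)
      \<le> ennreal \<mu> * (INF g \<in> closed_parametrizations K. curve_length g)"
    by (intro mult_left_mono) auto
  then show ?thesis
    by (simp add: inv mult.commute[of "ennreal \<mu>" "ennreal (inverse \<mu>)"] flip: mult.assoc)
qed

text \<open>The preceding inequality, applied to the homothety and to its inverse, gives equality of
  the infima. It holds for arbitrary sets, since an infinite infimum stays infinite.\<close>

lemma perimeter_homothety:
  assumes "\<mu> > 0"
  shows "perimeter ((\<lambda>x. \<mu> *\<^sub>R x + v) ` K) = \<mu> * perimeter K"
proof -
  define I where "I K = (INF g \<in> closed_parametrizations K. curve_length g)" for K
  let ?h = "\<lambda>x. \<mu> *\<^sub>R x + v"
  have inv: "ennreal \<mu> * ennreal (inverse \<mu>) = 1"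
    using assms by (simp flip: ennreal_mult')
  have "I K \<le> ennreal (inverse \<mu>) * I (?h ` K)"
    using INF_curve_length_homothety_le[of "inverse \<mu>" "- inverse \<mu> *\<^sub>R v" "?h ` K"] assms
    unfolding homothety_inverse_image[OF assms] I_def by simp
  then have "ennreal \<mu> * I K \<le> ennreal \<mu> * (ennreal (inverse \<mu>) * I (?h ` K))"
    by (intro mult_left_mono) auto
  also have "\<dots> = I (?h ` K)"
    by (simp add: inv flip: mult.assoc)
  finally have "I (?h ` K) = ennreal \<mu> * I K"
    using INF_curve_length_homothety_le[OF assms, of v K] unfolding I_def by (intro antisym)
  moreover have "perimeter L = enn2real (I L)" for L
    by (simp add: perimeter_def I_def closed_parametrizations_def)
  ultimately show ?thesis
    using assms by (simp add: enn2real_mult)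
qed

section \<open>Upper and lower bounds for arc length\<close>

lemma curve_length_Lipschitz_le:
  assumes "L \<ge> 0" and lip: "\<And>s t. s \<in> {0..1} \<Longrightarrow> t \<in> {0..1} \<Longrightarrow> dist (g s) (g t) \<le> L * dist s t"
  shows "curve_length g \<le> ennreal L"
  unfolding curve_length_def
proof (rule SUP_least)
  fix ts :: "real list" assume ts: "ts \<in> {ts. sorted ts \<and> set ts \<subseteq> {0..1}}"
  then have mem: "ts ! i \<in> {0..1}" if "i < length ts" for i
    using that nth_mem by blast
  have "(\<Sum>i<length ts - 1. dist (g (ts ! i)) (g (ts ! Suc i)))
      \<le> (\<Sum>i<length ts - 1. L * (ts ! Suc i - ts ! i))"
  proof (rule sum_mono)
    fix i assume i: "i \<in> {..<length ts - 1}"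
    then have "ts ! i \<le> ts ! Suc i"
      using ts by (auto intro: sorted_nth_mono)
    then show "dist (g (ts ! i)) (g (ts ! Suc i)) \<le> L * (ts ! Suc i - ts ! i)"
      using lip[OF mem mem, of i "Suc i"] i by (auto simp: dist_real_def)
  qed
  also have "\<dots> = L * (ts ! (length ts - 1) - ts ! 0)"
    by (simp add: sum_lessThan_telescope flip: sum_distrib_left)
  also have "\<dots> \<le> L"
  \<comment> \<open>For the empty list truncated subtraction makes both indices 0, so the difference
    vanishes although the entries are unspecified.\<close>
  proof (cases "ts = []")
    case False
    then show ?thesis
      using mem[of 0] mem[of "length ts - 1"] \<open>L \<ge> 0\<close> by (intro mult_left_le) auto
  qed (use \<open>L \<ge> 0\<close> in auto)
  finally show "ennreal (\<Sum>i<length ts - 1. dist (g (ts ! i)) (g (ts ! Suc i))) \<le> ennreal L"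
    by (rule ennreal_leI)
qed

lemma dist_le_curve_length:
  assumes "p \<in> path_image g" "q \<in> path_image g"
  shows "ennreal (dist p q) \<le> curve_length g"
proof -
  obtain s t where st: "s \<in> {0..1}" "t \<in> {0..1}" "p = g s" "q = g t"
    using assms by (auto simp: path_image_def)
  have *: "ennreal (dist (g s) (g t)) \<le> curve_length g"
    if "s \<le> t" "s \<in> {0..1}" "t \<in> {0..1}" for s t
    unfolding curve_length_def
    by (rule SUP_upper2[of "[s, t]"]) (use that in auto)
  show ?thesis
  proof (cases "s \<le> t")
    case True
    then show ?thesis using *[OF True] st by blast
  next
    case False
    then show ?thesis using *[of t s] st by (simp add: dist_commute)
  qed
qed

text \<open>Every parametrization passes through the two distinct frontier points \<open>g 0\<close>
  and \<open>g (1/2)\<close>, so their distance bounds the infimum from below. The length of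
  \<open>g\<close> keeps the infimum finite, as \<open>enn2real\<close> requires.\<close>

lemma perimeter_pos_if_rectifiable:
  assumes "g \<in> closed_parametrizations K" "curve_length g < \<infinity>"
  shows "perimeter K > 0"
proof -
  let ?I = "INF g \<in> closed_parametrizations K. curve_length g"
  have "g 0 \<noteq> g (1/2)"
  proof
    assume "g 0 = g (1/2)"
    moreover have "loop_free g"
      using assms(1) by (simp add: closed_parametrizations_def simple_path_def)
    ultimately have "(0::real) = 1/2 \<or> (0::real) = 0 \<and> (1/2::real) = 1 \<or> (0::real) = 1 \<and> (1/2::real) = 0"
      unfolding loop_free_def by (elim ballE[of _ _ 0] ballE[of _ _ "1/2"]) auto
    then show False by simp
  qed
  moreover have "g 0 \<in> path_image g" "g (1/2) \<in> path_image g"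
    by (auto simp: path_image_def)
  then have "g 0 \<in> frontier K" "g (1/2) \<in> frontier K"
    using assms(1) by (auto simp: closed_parametrizations_def)
  then have "ennreal (dist (g 0) (g (1/2))) \<le> ?I"
    by (intro INF_greatest dist_le_curve_length) (auto simp: closed_parametrizations_def)
  ultimately have "0 < ?I"
    using less_le_trans[of 0 "ennreal (dist (g 0) (g (1/2)))" ?I] by simp
  moreover have "?I < top"
    using le_less_trans[OF INF_lower[OF assms(1), of curve_length]] assms(2) by simp
  ultimately show ?thesis
    by (simp add: perimeter_def enn2real_positive_iff flip: closed_parametrizations_def)
qed

subsection \<open>Finiteness of the perimeter of a convex body\<close>

text \<open>For a body containing the origin, the support function of the polar body is the Minkowski
  functional; sublinearity is immediate from this description.\<close>

definition gauge_functional :: "plane set \<Rightarrow> plane \<Rightarrow> real" where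
  "gauge_functional K x = (SUP a \<in> {a. \<forall>y\<in>K. a \<bullet> y \<le> 1}. a \<bullet> x)"

locale centered_body =
  fixes K :: "plane set" and r R :: real
  assumes compact: "compact K" and convex: "convex K"
    and r: "r > 0" "cball 0 r \<subseteq> K" and R: "R > 0" "K \<subseteq> cball 0 R"
begin

abbreviation "\<gamma> \<equiv> gauge_functional K"

text \<open>Testing \<open>a\<close> on the point of norm \<open>r\<close> in its own direction
  gives \<open>norm a \<le> 1 / r\<close>. This also makes the supremum in
  \<open>gauge_functional\<close> finite.\<close>

lemma inner_le_norm_div:
  assumes "\<forall>y\<in>K. a \<bullet> y \<le> 1"
  shows "a \<bullet> x \<le> norm x / r"
proof (cases "a = 0")
  case False
  have "(r / norm a) *\<^sub>R a \<in> K"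
    using r False by (intro subsetD[OF r(2)]) simp
  then have "a \<bullet> ((r / norm a) *\<^sub>R a) \<le> 1"
    using assms by blast
  then have "r * norm a \<le> 1"
    using False by (simp add: dot_square_norm power2_eq_square)
  then have "norm a \<le> 1 / r"
    using r by (simp add: field_simps)
  then have "norm a * norm x \<le> 1 / r * norm x"
    by (intro mult_right_mono) auto
  then show ?thesis
    using norm_cauchy_schwarz[of a x] by simp
qed (use r in auto)

lemma inner_le_gauge: "\<forall>y\<in>K. a \<bullet> y \<le> 1 \<Longrightarrow> a \<bullet> x \<le> \<gamma> x"
  unfolding gauge_functional_def
  by (rule cSUP_upper) (auto intro!: bdd_aboveI2[of _ _ "norm x / r"] inner_le_norm_div)

lemma gauge_least: "(\<And>a. \<forall>y\<in>K. a \<bullet> y \<le> 1 \<Longrightarrow> a \<bullet> x \<le> c) \<Longrightarrow> \<gamma> x \<le> c"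
  unfolding gauge_functional_def by (rule cSUP_least) (auto intro!: exI[of _ 0])

lemma gauge_triangle: "\<gamma> (x + y) \<le> \<gamma> x + \<gamma> y"
  by (rule gauge_least) (simp add: inner_right_distrib inner_le_gauge add_mono)

lemma gauge_scaleR_le: "c \<ge> 0 \<Longrightarrow> \<gamma> (c *\<^sub>R x) \<le> c * \<gamma> x"
  by (rule gauge_least) (simp add: inner_le_gauge mult_left_mono)

lemma gauge_scaleR:
  assumes "c > 0"
  shows "\<gamma> (c *\<^sub>R x) = c * \<gamma> x"
proof -
  have "\<gamma> x \<le> inverse c * \<gamma> (c *\<^sub>R x)"
    using gauge_scaleR_le[of "inverse c" "c *\<^sub>R x"] assms by simp
  then show ?thesis
    using gauge_scaleR_le[of c x] assms by (simp add: field_simps)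
qed

lemma gauge_upper: "\<gamma> x \<le> norm x / r"
  by (rule gauge_least) (rule inner_le_norm_div)

text \<open>The unit vector along \<open>x\<close>, divided by \<open>R\<close>, is an admissible
  functional because \<open>K\<close> lies in the disc of radius \<open>R\<close>.\<close>

lemma gauge_lower: "norm x / R \<le> \<gamma> x"
proof (cases "x = 0")
  case False
  let ?a = "(1 / (norm x * R)) *\<^sub>R x"
  have "?a \<bullet> y \<le> 1" if "y \<in> K" for y
  proof -
    have "x \<bullet> y \<le> norm x * norm y"
      by (rule norm_cauchy_schwarz)
    also have "\<dots> \<le> norm x * R"
      using R that by (intro mult_left_mono) auto
    finally show ?thesis
      using R False by simp
  qed
  then have "?a \<bullet> x \<le> \<gamma> x"
    by (intro inner_le_gauge) auto
  then show ?thesis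
    using False by (simp add: dot_square_norm power2_eq_square)
qed (use inner_le_gauge[of 0 0] in auto)

lemma gauge_pos: "x \<noteq> 0 \<Longrightarrow> \<gamma> x > 0"
  using gauge_lower[of x] R by (meson divide_pos_pos less_le_trans zero_less_norm_iff)

lemma gauge_Lipschitz: "\<bar>\<gamma> x - \<gamma> y\<bar> \<le> norm (x - y) / r"
  using gauge_triangle[of "x - y" y] gauge_triangle[of "y - x" x]
    gauge_upper[of "x - y"] gauge_upper[of "y - x"] by (simp add: norm_minus_commute)

text \<open>A point outside \<open>K\<close> is strictly separated from \<open>K\<close>. Since
  \<open>0\<close> is in \<open>K\<close>, the separating value \<open>b\<close> is negative, and
  \<open>a / b\<close> is an admissible functional exceeding 1 at the point.\<close>

lemma gauge_le_1_iff: "\<gamma> x \<le> 1 \<longleftrightarrow> x \<in> K"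
proof
  assume le: "\<gamma> x \<le> 1"
  show "x \<in> K"
  proof (rule ccontr)
    assume "x \<notin> K"
    then obtain a b where ab: "a \<bullet> x < b" "\<And>y. y \<in> K \<Longrightarrow> b < a \<bullet> y"
      using separating_hyperplane_closed_point[OF convex compact_imp_closed[OF compact]] by blast
    have "0 \<in> K" using r by auto
    then have "b < 0" using ab(2) by force
    have "\<forall>y\<in>K. ((1 / b) *\<^sub>R a) \<bullet> y \<le> 1"
      using ab(2) \<open>b < 0\<close> by (auto simp: divide_simps less_imp_le)
    then have "(1 / b) *\<^sub>R a \<bullet> x \<le> 1"
      using inner_le_gauge le by (metis order_trans)
    then show False
      using ab(1) \<open>b < 0\<close> by (simp add: divide_simps)
  qed
next
  show "x \<in> K \<Longrightarrow> \<gamma> x \<le> 1"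
    by (rule gauge_least) auto
qed

lemma continuous_gauge: "continuous_on UNIV \<gamma>"
proof (rule lipschitz_on_continuous_on)
  show "(1 / r)-lipschitz_on UNIV \<gamma>"
    using r gauge_Lipschitz by (intro lipschitz_onI) (auto simp: dist_norm)
qed

lemma interior_conv_gauge: "interior K = {x. \<gamma> x < 1}"
proof
  show "{x. \<gamma> x < 1} \<subseteq> interior K"
  proof (rule interior_maximal)
    show "{x. \<gamma> x < 1} \<subseteq> K"
      by (auto simp flip: gauge_le_1_iff)
    show "open {x. \<gamma> x < 1}"
      using continuous_gauge by (intro open_Collect_less) auto
  qed
  show "interior K \<subseteq> {x. \<gamma> x < 1}"
  proof (rule ccontr)
    assume "\<not> interior K \<subseteq> {x. \<gamma> x < 1}"
    then obtain x where x: "x \<in> interior K" "\<gamma> x \<ge> 1" by force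
    then obtain e where e: "e > 0" "ball x e \<subseteq> K"
      using mem_interior by blast
    have "x \<noteq> 0" using gauge_upper[of 0] x by auto
    \<comment> \<open>Scaling by \<open>?c\<close> moves \<open>x\<close> by only
      \<open>e / 2\<close>, hence inside \<open>K\<close>, but multiplies a gauge of at least 1 by a
      factor greater than 1.\<close>
    let ?c = "1 + e / (2 * norm x)"
    have "?c *\<^sub>R x \<in> ball x e"
      using e \<open>x \<noteq> 0\<close> by (simp add: dist_norm algebra_simps)
    then have "?c * \<gamma> x \<le> 1"
      using e gauge_le_1_iff[of "?c *\<^sub>R x"] gauge_scaleR[of ?c x] by (auto simp: add_pos_nonneg)
    moreover have "?c * \<gamma> x \<ge> ?c * 1"
      using x e by (intro mult_left_mono) auto
    moreover have "?c > 1"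
      using e \<open>x \<noteq> 0\<close> by simp
    moreover have "?c * 1 \<le> 1"
      using calculation(1,2) by (rule order_trans[rotated])
    ultimately show False by simp
  qed
qed

lemma frontier_conv_gauge: "frontier K = {x. \<gamma> x = 1}"
  unfolding frontier_def interior_conv_gauge
  by (auto simp: closure_closed[OF compact_imp_closed[OF compact]] simp flip: gauge_le_1_iff)

section \<open>Radial parametrization of the boundary\<close>

definition direction :: "real \<Rightarrow> plane" where
  "direction t = vector [cos (2 * pi * t), sin (2 * pi * t)]"

definition radial :: "real \<Rightarrow> plane" where
  "radial t = (1 / \<gamma> (direction t)) *\<^sub>R direction t"

lemma norm_direction [simp]: "norm (direction t) = 1"
  by (simp add: direction_def norm_eq_sqrt_inner inner_vec_def sum_2 flip: power2_eq_square)

lemma direction_nonzero [simp]: "direction t \<noteq> 0"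
  using norm_direction[of t] by (metis norm_zero zero_neq_one)

text \<open>The sum of the coordinate differences bounds the distance; by the sum-to-product
  formulas each coordinate contributes \<open>2 * pi\<close>.\<close>

lemma direction_Lipschitz: "dist (direction s) (direction t) \<le> 4 * pi * dist s t"
proof -
  have sin: "\<bar>sin x * y\<bar> \<le> \<bar>x\<bar>" "\<bar>y * sin x\<bar> \<le> \<bar>x\<bar>" if "\<bar>y\<bar> \<le> 1" for x y :: real
    using that abs_sin_x_le_abs_x[of x] mult_mono[of "\<bar>sin x\<bar>" "\<bar>x\<bar>" "\<bar>y\<bar>" 1]
    by (auto simp: abs_mult mult.commute)
  have "dist (direction s) (direction t)
      \<le> \<bar>cos (2 * pi * s) - cos (2 * pi * t)\<bar> + \<bar>sin (2 * pi * s) - sin (2 * pi * t)\<bar>"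
    using norm_le_l1_cart[of "direction s - direction t"] by (simp add: dist_norm sum_2 direction_def)
  also have "\<bar>cos (2 * pi * s) - cos (2 * pi * t)\<bar> \<le> 2 * \<bar>(2 * pi * t - 2 * pi * s) / 2\<bar>"
    using sin(2)[of "sin ((2 * pi * s + 2 * pi * t) / 2)" "(2 * pi * t - 2 * pi * s) / 2"]
    by (simp only: cos_diff_cos abs_mult mult.assoc) simp
  also have "\<bar>sin (2 * pi * s) - sin (2 * pi * t)\<bar> \<le> 2 * \<bar>(2 * pi * s - 2 * pi * t) / 2\<bar>"
    using sin(1)[of "cos ((2 * pi * s + 2 * pi * t) / 2)" "(2 * pi * s - 2 * pi * t) / 2"]
    by (simp only: sin_diff_sin abs_mult mult.assoc) simp
  finally show ?thesis
    by (simp add: dist_real_def abs_minus_commute abs_mult flip: right_diff_distrib)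
qed

lemma direction_eq_iff: "direction s = direction t \<longleftrightarrow> (\<exists>n::int. s = t + of_int n)"
proof -
  have "direction s = direction t \<longleftrightarrow> (\<exists>n::int. 2 * pi * s = 2 * pi * t + 2 * pi * n)"
    unfolding sin_cos_eq_iff[symmetric] direction_def by (auto simp: vec_eq_iff forall_2)
  also have "\<dots> \<longleftrightarrow> (\<exists>n::int. s = t + of_int n)"
    by (simp flip: distrib_left)
  finally show ?thesis .
qed

lemma radial_eq_iff: "radial s = radial t \<longleftrightarrow> direction s = direction t"
proof
  assume eq: "radial s = radial t"
  have "norm (radial u) = 1 / \<gamma> (direction u)" for u
    using gauge_pos[of "direction u"] by (simp add: radial_def)
  then have "\<gamma> (direction s) = \<gamma> (direction t)"
    using eq by (metis div_by_1 divide_divide_eq_right mult_1)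
  then show "direction s = direction t"
    using eq gauge_pos[of "direction t"] by (simp add: radial_def)
qed (simp add: radial_def)

text \<open>The difference splits into a change of direction and a change of the scaling factor
  \<open>1 / \<gamma>\<close>. This factor is at most \<open>R\<close>, and \<open>\<gamma>\<close>
  is Lipschitz with constant \<open>1 / r\<close>.\<close>

lemma radial_Lipschitz: "dist (radial s) (radial t) \<le> (R + R\<^sup>2 / r) * (4 * pi) * dist s t"
proof -
  let ?x = "direction s" and ?y = "direction t"
  have inv: "1 / \<gamma> (direction u) \<le> R" "1 / \<gamma> (direction u) > 0" for u
    using gauge_lower[of "direction u"] gauge_pos[of "direction u"] R by (auto simp: field_simps)
  have "radial s - radial t = (1 / \<gamma> ?x) *\<^sub>R (?x - ?y) + (1 / \<gamma> ?x - 1 / \<gamma> ?y) *\<^sub>R ?y"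
    by (simp add: radial_def algebra_simps)
  then have "norm (radial s - radial t) \<le> 1 / \<gamma> ?x * norm (?x - ?y) + \<bar>1 / \<gamma> ?x - 1 / \<gamma> ?y\<bar>"
    using inv(2)[of s] norm_triangle_ineq[of "(1 / \<gamma> ?x) *\<^sub>R (?x - ?y)" "(1 / \<gamma> ?x - 1 / \<gamma> ?y) *\<^sub>R ?y"] by simp
  also have "1 / \<gamma> ?x - 1 / \<gamma> ?y = (1 / \<gamma> ?x) * (1 / \<gamma> ?y) * (\<gamma> ?y - \<gamma> ?x)"
    using gauge_pos[of ?x] gauge_pos[of ?y] by (simp add: field_simps)
  also have "\<bar>\<dots>\<bar> = ((1 / \<gamma> ?x) * (1 / \<gamma> ?y)) * \<bar>\<gamma> ?y - \<gamma> ?x\<bar>"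
    using inv(2)[of s] inv(2)[of t] by (simp add: abs_mult)
  also have "\<dots> \<le> (R * R) * (norm (?x - ?y) / r)"
    using inv gauge_Lipschitz[of ?y ?x] R
    by (intro mult_mono) (auto simp: norm_minus_commute less_imp_le)
  also have "1 / \<gamma> ?x * norm (?x - ?y) \<le> R * norm (?x - ?y)"
    using inv by (intro mult_right_mono) auto
  finally have "dist (radial s) (radial t) \<le> (R + R\<^sup>2 / r) * dist ?x ?y"
    by (simp add: dist_norm power2_eq_square algebra_simps)
  also have "\<dots> \<le> (R + R\<^sup>2 / r) * (4 * pi * dist s t)"
    using R r direction_Lipschitz by (intro mult_left_mono) auto
  finally show ?thesis by (simp add: algebra_simps)
qed

lemma radial_closed_parametrization: "radial \<in> closed_parametrizations K"
proof -
  let ?L = "(R + R\<^sup>2 / r) * (4 * pi)"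
  have L: "?L > 0"
    using R r by (auto intro!: mult_pos_pos add_pos_pos)
  have "path radial"
    unfolding path_def
  proof (rule lipschitz_on_continuous_on)
    show "?L-lipschitz_on {0..1} radial"
      using L radial_Lipschitz by (intro lipschitz_onI) auto
  qed
  moreover have "loop_free radial"
    unfolding loop_free_def
  proof (intro ballI impI)
    fix x y :: real assume xy: "x \<in> {0..1}" "y \<in> {0..1}" "radial x = radial y"
    then obtain n :: int where n: "x = y + of_int n"
      by (auto simp: radial_eq_iff direction_eq_iff)
    then have "n \<in> {-1..1}" using xy by auto
    then have "n = -1 \<or> n = 0 \<or> n = 1" by auto
    then show "x = y \<or> x = 0 \<and> y = 1 \<or> x = 1 \<and> y = 0"
      using n xy by auto
  qed
  moreover have "pathfinish radial = pathstart radial"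
    unfolding pathfinish_def pathstart_def by (simp add: radial_def direction_def)
  moreover have "path_image radial = frontier K"
  proof
    show "path_image radial \<subseteq> frontier K"
      using gauge_pos[of "direction _"]
      by (auto simp: path_image_def frontier_conv_gauge radial_def gauge_scaleR)
        (metis direction_nonzero less_irrefl)
    show "frontier K \<subseteq> path_image radial"
    proof
      fix x assume "x \<in> frontier K"
      then have x: "\<gamma> x = 1" by (simp add: frontier_conv_gauge)
      then have "x \<noteq> 0" using gauge_upper[of 0] by auto
      define y where "y = (1 / norm x) *\<^sub>R x"
      have "norm y = 1" using \<open>x \<noteq> 0\<close> by (simp add: y_def)
      then have "(y $ 1)\<^sup>2 + (y $ 2)\<^sup>2 = 1"
        by (simp add: norm_eq_sqrt_inner inner_vec_def sum_2 power2_eq_square)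
      then obtain t where t: "0 \<le> t" "t < 2 * pi" "y $ 1 = cos t" "y $ 2 = sin t"
        using sincos_total_2pi by blast
      then have "y = direction (t / (2 * pi))"
        by (simp add: direction_def vec_eq_iff forall_2)
      moreover have "(1 / \<gamma> y) *\<^sub>R y = x"
        using \<open>x \<noteq> 0\<close> x by (simp add: y_def gauge_scaleR)
      ultimately have "x = radial (t / (2 * pi))"
        by (simp add: radial_def)
      moreover have "t / (2 * pi) \<in> {0..1}"
        using t by auto
      ultimately show "x \<in> path_image radial"
        by (auto simp: path_image_def)
    qed
  qed
  ultimately show ?thesis
    by (simp add: closed_parametrizations_def simple_path_def)
qed

lemma perimeter_centered_pos: "perimeter K > 0"
proof (rule perimeter_pos_if_rectifiable[OF radial_closed_parametrization])
  have "curve_length radial \<le> ennreal ((R + R\<^sup>2 / r) * (4 * pi))"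
    using R r by (intro curve_length_Lipschitz_le radial_Lipschitz) auto
  then show "curve_length radial < \<infinity>"
    by (metis ennreal_less_top infinity_ennreal_def le_less_trans)
qed

end

lemma perimeter_pos:
  assumes "convex_body K"
  shows "perimeter K > 0"
proof -
  obtain p r where p: "r > 0" "cball p r \<subseteq> K"
    using assms mem_interior_cball unfolding convex_body_def by blast
  let ?K = "(\<lambda>x. 1 *\<^sub>R x + (- p)) ` K"
  have K: "convex_body ?K"
    using convex_body_homothety[OF _ assms, of 1 "- p"] by simp
  then obtain R where R: "R > 0" "?K \<subseteq> cball 0 R"
    unfolding convex_body_def using compact_imp_bounded[of ?K] bounded_pos[of ?K]
    by (auto simp: subset_iff)
  have "cball 0 r \<subseteq> ?K"
  proof
    fix x :: plane assume "x \<in> cball 0 r"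
    then have "p + x \<in> K" using p by (auto simp: dist_norm intro!: subsetD[OF p(2)])
    then show "x \<in> ?K" by (auto intro!: image_eqI[of _ _ "p + x"])
  qed
  then interpret centered_body ?K r R
    using K p R by unfold_locales (auto simp: convex_body_def)
  show ?thesis
    using perimeter_centered_pos perimeter_homothety[of 1 "- p" K] by simp
qed

subsection \<open>Sides and facets in orthonormal frames\<close>

lemma left_normal_components [simp]: "left_normal d $ 1 = - d $ 2" "left_normal d $ 2 = d $ 1"
  by (simp_all add: left_normal_def)

lemma inner_plane: "x \<bullet> y = x $ 1 * y $ 1 + x $ 2 * y $ 2" for x y :: plane
  by (simp add: inner_vec_def sum_2)

lemma inner_left_normal [simp]: "d \<bullet> left_normal d = 0" "left_normal d \<bullet> d = 0"
  by (simp_all add: inner_plane)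

lemma inner_left_normal_self [simp]: "left_normal d \<bullet> left_normal d = d \<bullet> d"
  by (simp add: inner_plane)

lemma norm_left_normal [simp]: "norm (left_normal d) = norm d"
  by (simp add: norm_eq_sqrt_inner)

lemma frame_expansion:
  assumes "norm d = 1"
  shows "(d \<bullet> x) *\<^sub>R d + (left_normal d \<bullet> x) *\<^sub>R left_normal d = x"
proof -
  have 1: "d $ 1 * d $ 1 + d $ 2 * d $ 2 = 1"
    using assms by (simp add: norm_eq_1 inner_plane)
  show ?thesis
    unfolding vec_eq_iff forall_2 using 1 by (simp add: inner_plane) algebra
qed

lemma frame_eqI:
  assumes "norm d = 1" "d \<bullet> x = d \<bullet> y" "left_normal d \<bullet> x = left_normal d \<bullet> y"
  shows "x = y"
  using frame_expansion[OF assms(1), of x] frame_expansion[OF assms(1), of y] assms(2,3) by metis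

definition frame_box :: "plane \<Rightarrow> real \<Rightarrow> real \<Rightarrow> real \<Rightarrow> real \<Rightarrow> plane set" where
  "frame_box d s s' t t' = {x. d \<bullet> x \<in> {s..s'} \<and> left_normal d \<bullet> x \<in> {t..t'}}"

definition frame_point :: "plane \<Rightarrow> real \<Rightarrow> real \<Rightarrow> plane" where
  "frame_point d s t = s *\<^sub>R d + t *\<^sub>R left_normal d"

lemma inner_frame_point:
  assumes "norm d = 1"
  shows "d \<bullet> frame_point d s t = s" "left_normal d \<bullet> frame_point d s t = t"
  using assms by (simp_all add: frame_point_def inner_right_distrib norm_eq_1)

text \<open>Both ends of the side minimize the height over \<open>K\<close>, so they have equal
  height; being distinct, they differ along \<open>d\<close> and can be ordered.\<close>

lemma has_side_endpoints:
  assumes "norm d = 1" "has_side d K"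
  obtains a b where "a \<in> K" "b \<in> K" "d \<bullet> a < d \<bullet> b"
    "left_normal d \<bullet> b = left_normal d \<bullet> a" "\<forall>x\<in>K. left_normal d \<bullet> a \<le> left_normal d \<bullet> x"
proof -
  obtain a b where ab: "a \<noteq> b" "supporting_line d K \<inter> K = closed_segment a b"
    using assms by (auto simp: has_side_def)
  have flat: "y \<in> K \<and> (\<forall>x\<in>K. left_normal d \<bullet> y \<le> left_normal d \<bullet> x)" if "y \<in> closed_segment a b" for y
    using that unfolding ab(2)[symmetric] supporting_line_def
    by (auto simp: inner_right_distrib inner_diff_right)
  have a: "a \<in> K" "\<forall>x\<in>K. left_normal d \<bullet> a \<le> left_normal d \<bullet> x"
    and b: "b \<in> K" "\<forall>x\<in>K. left_normal d \<bullet> b \<le> left_normal d \<bullet> x"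
    using flat by auto
  then have eq: "left_normal d \<bullet> b = left_normal d \<bullet> a"
    by (intro antisym) auto
  then have "d \<bullet> a \<noteq> d \<bullet> b"
    using frame_eqI[OF assms(1)] ab(1) by metis
  then consider "d \<bullet> a < d \<bullet> b" | "d \<bullet> b < d \<bullet> a" by linarith
  then show thesis
  proof cases
    case 1
    then show thesis by (rule that[OF a(1) b(1) _ eq a(2)])
  next
    case 2
    then show thesis by (rule that[OF b(1) a(1) _ eq[symmetric] b(2)])
  qed
qed

text \<open>The triangle spanned by the side and an interior point of \<open>K\<close> contains a
  sufficiently low rectangle over the middle third of the side.\<close>

lemma side_box:
  assumes "convex_body K" "norm d = 1" "has_side d K"
  obtains s s' m h where "s < s'" "h > 0" "\<forall>x\<in>K. m \<le> left_normal d \<bullet> x"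
    "frame_box d s s' m (m + h) \<subseteq> K"
proof -
  let ?n = "left_normal d"
  obtain a b where ab: "a \<in> K" "b \<in> K" "d \<bullet> a < d \<bullet> b" "?n \<bullet> b = ?n \<bullet> a"
    "\<forall>x\<in>K. ?n \<bullet> a \<le> ?n \<bullet> x"
    using has_side_endpoints[OF assms(2,3)] by metis
  obtain c e where c: "e > 0" "cball c e \<subseteq> K"
    using assms(1) mem_interior_cball unfolding convex_body_def by blast
  have "c - e *\<^sub>R ?n \<in> K"
    using c assms(2) by (intro subsetD[OF c(2)]) (simp add: dist_norm)
  then have "?n \<bullet> a \<le> ?n \<bullet> (c - e *\<^sub>R ?n)"
    using ab(5) by blast
  then have c_above: "?n \<bullet> a < ?n \<bullet> c"
    using c assms(2) by (simp add: inner_diff_right norm_eq_1)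
  have "c \<in> K" using c by auto
  define w H p where "w = d \<bullet> b - d \<bullet> a" and "H = ?n \<bullet> c - ?n \<bullet> a" and "p = d \<bullet> c - d \<bullet> a"
  have pos: "w > 0" "H > 0" "w + \<bar>p\<bar> > 0"
    using ab c_above by (auto simp: w_def H_def)
  \<comment> \<open>This height makes \<open>k * (w + \<bar>p\<bar>) \<le> w / 3\<close> for the
    weight \<open>k\<close> of the apex: its horizontal shift \<open>k * p\<close> and its share of
    the width both fit into the outer thirds.\<close>
  define h where "h = H * (w / (3 * (w + \<bar>p\<bar>)))"
  have "frame_box d (d \<bullet> a + w / 3) (d \<bullet> a + 2 * w / 3) (?n \<bullet> a) (?n \<bullet> a + h) \<subseteq> K"
  proof
    fix x assume "x \<in> frame_box d (d \<bullet> a + w / 3) (d \<bullet> a + 2 * w / 3) (?n \<bullet> a) (?n \<bullet> a + h)"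
    then have x: "w / 3 \<le> d \<bullet> x - d \<bullet> a" "d \<bullet> x - d \<bullet> a \<le> 2 * w / 3"
      "0 \<le> ?n \<bullet> x - ?n \<bullet> a" "?n \<bullet> x - ?n \<bullet> a \<le> h"
      by (auto simp: frame_box_def)
    txt \<open>Barycentric coordinates of \<open>x\<close> in the triangle \<open>a b c\<close>.\<close>
    define k where "k = (?n \<bullet> x - ?n \<bullet> a) / H"
    define l where "l = (d \<bullet> x - d \<bullet> a - k * p) / w"
    have k0: "0 \<le> k" using x pos by (simp add: k_def)
    have "k \<le> h / H"
      using x(4) pos unfolding k_def by (intro divide_right_mono) auto
    also have "h / H = w / (3 * (w + \<bar>p\<bar>))"
      using pos by (simp add: h_def)
    finally have "k * (w + \<bar>p\<bar>) \<le> w / 3"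
      using pos by (simp add: field_simps)
    then have kw: "k * w + \<bar>k * p\<bar> \<le> w / 3"
      using k0 by (simp add: abs_mult algebra_simps)
    moreover have "k * w \<ge> 0" using k0 pos by simp
    ultimately have kp: "\<bar>k * p\<bar> \<le> w / 3" by linarith
    have l0: "0 \<le> l"
      using x(1) kp pos by (auto simp: l_def)
    have "(l + k) * w = d \<bullet> x - d \<bullet> a - k * p + k * w"
      using pos by (simp add: l_def field_simps)
    also have "\<dots> \<le> 1 * w"
      using x(2) kw by linarith
    finally have lk: "l + k \<le> 1" using pos by simp
    have "x = (1 - l - k) *\<^sub>R a + l *\<^sub>R b + k *\<^sub>R c"
    proof (rule frame_eqI[OF assms(2)])
      have "d \<bullet> ((1 - l - k) *\<^sub>R a + l *\<^sub>R b + k *\<^sub>R c) = d \<bullet> a + l * w + k * p"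
        by (simp add: inner_right_distrib w_def p_def algebra_simps)
      also have "l * w = d \<bullet> x - d \<bullet> a - k * p"
        using pos by (simp add: l_def)
      finally show "d \<bullet> x = d \<bullet> ((1 - l - k) *\<^sub>R a + l *\<^sub>R b + k *\<^sub>R c)" by simp
      have "?n \<bullet> ((1 - l - k) *\<^sub>R a + l *\<^sub>R b + k *\<^sub>R c) = ?n \<bullet> a + k * H"
        using ab(4) by (simp add: inner_right_distrib H_def algebra_simps)
      also have "k * H = ?n \<bullet> x - ?n \<bullet> a"
        using pos by (simp add: k_def)
      finally show "?n \<bullet> x = ?n \<bullet> ((1 - l - k) *\<^sub>R a + l *\<^sub>R b + k *\<^sub>R c)" by simp
    qed
    moreover have "(1 - l - k) *\<^sub>R a + l *\<^sub>R b + k *\<^sub>R c \<in> convex hull {a, b, c}"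
      unfolding convex_hull_3 using k0 l0 lk
      by (intro CollectI exI[of _ "1 - l - k"] exI[of _ l] exI[of _ k]) auto
    moreover have "convex hull {a, b, c} \<subseteq> K"
      using assms(1) ab \<open>c \<in> K\<close> by (intro hull_minimal) (auto simp: convex_body_def)
    ultimately show "x \<in> K" by auto
  qed
  moreover have "h > 0" using pos by (simp add: h_def)
  ultimately show thesis
    using that[of "d \<bullet> a + w / 3" "d \<bullet> a + 2 * w / 3" h "?n \<bullet> a"] ab pos by simp
qed

section \<open>Facets of the polygon as sides\<close>

text \<open>A facet of a polyhedron is exposed by a functional, and the dimensions 1 and 2 force
  that functional to be nonzero and the facet to be a nondegenerate segment.\<close>

lemma facet_supporting_frame:
  assumes "convex_body D" "polytope D" "F facet_of D"
  obtains d b where "norm d = 1" "has_side d D" "\<forall>x\<in>D. b \<le> left_normal d \<bullet> x"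
    "F = D \<inter> {x. left_normal d \<bullet> x = b}"
proof -
  have polyD: "polyhedron D" using assms(2) polytope_imp_polyhedron by blast
  have "F face_of D" using assms(3) facet_of_imp_face_of by blast
  then obtain a0 b0 where F: "D \<subseteq> {x. a0 \<bullet> x \<le> b0}" "F = D \<inter> {x. a0 \<bullet> x = b0}"
    using exposed_face_of_polyhedron[OF polyD] unfolding exposed_face_of_def by metis
  have affD: "aff_dim D = 2"
    using assms(1) by (simp add: convex_body_def aff_dim_nonempty_interior)
  have affF: "aff_dim F = 1"
    using assms(3) affD by (simp add: facet_of_def)
  have "a0 \<noteq> 0"
  proof
    assume "a0 = 0"
    then have "F = D \<or> F = {}" using F by auto
    then show False using affD affF by auto
  qed
  \<comment> \<open>The negative factor turns the outer normal \<open>a0\<close> into the inner unit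
    normal; \<open>d\<close> is this normal turned clockwise, so that \<open>left_normal d\<close>
    recovers it.\<close>
  define c where "c = - (1 / norm a0)"
  have "c < 0" using \<open>a0 \<noteq> 0\<close> by (simp add: c_def)
  define d :: plane where "d = vector [c * a0 $ 2, - (c * a0 $ 1)]"
  have n: "left_normal d = c *\<^sub>R a0"
    unfolding vec_eq_iff forall_2 by (simp add: d_def)
  have "norm (left_normal d) = 1"
    using \<open>a0 \<noteq> 0\<close> unfolding n by (simp add: c_def)
  then have norm: "norm d = 1" by simp
  have low: "\<forall>x\<in>D. c * b0 \<le> left_normal d \<bullet> x"
    using F(1) \<open>c < 0\<close> unfolding n by (auto simp: mult_le_cancel_left)
  have Feq: "F = D \<inter> {x. left_normal d \<bullet> x = c * b0}"
    using F(2) \<open>c < 0\<close> unfolding n by auto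
  have "convex F" "compact F"
    using \<open>F face_of D\<close> assms(1) face_of_imp_convex face_of_imp_compact
    unfolding convex_body_def by blast+
  moreover have "collinear F" using affF by (simp add: collinear_aff_dim)
  moreover have "F \<noteq> {}" using affF by auto
  ultimately obtain a b where ab: "F = closed_segment a b"
    using compact_convex_collinear_segment by blast
  then have "a \<noteq> b" using affF by auto
  have "supporting_line d D \<inter> D = F"
  proof
    have "F \<noteq> {}" using ab by auto
    then obtain y where y: "y \<in> D" "left_normal d \<bullet> y = c * b0"
      unfolding Feq by blast
    show "supporting_line d D \<inter> D \<subseteq> F"
    proof
      fix x assume x: "x \<in> supporting_line d D \<inter> D"
      then obtain p t where p: "x = p + t *\<^sub>R d" "p \<in> D" "\<forall>x\<in>D. 0 \<le> left_normal d \<bullet> (x - p)"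
        unfolding supporting_line_def by blast
      have "left_normal d \<bullet> x = left_normal d \<bullet> p"
        using p(1) by (simp add: inner_right_distrib)
      also have "\<dots> = c * b0"
      proof (rule antisym)
        show "left_normal d \<bullet> p \<le> c * b0"
          using bspec[OF p(3) y(1)] y(2) by (simp add: inner_diff_right)
        show "c * b0 \<le> left_normal d \<bullet> p"
          using low p(2) by blast
      qed
      finally show "x \<in> F" using x unfolding Feq by blast
    qed
    show "F \<subseteq> supporting_line d D \<inter> D"
    proof
      fix x assume "x \<in> F"
      then have x: "x \<in> D" "\<forall>y\<in>D. 0 \<le> left_normal d \<bullet> (y - x)"
        using low unfolding Feq by (auto simp: inner_diff_right)
      moreover have "x = x + 0 *\<^sub>R d" by simp
      ultimately show "x \<in> supporting_line d D \<inter> D"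
        unfolding supporting_line_def by blast
    qed
  qed
  then have "has_side d D"
    using \<open>a \<noteq> b\<close> ab by (auto simp: has_side_def)
  then show thesis
    using that norm low Feq by blast
qed

lemma frontier_polytope_facets:
  assumes "convex_body D" "polytope D"
  shows "frontier D = \<Union>{F. F facet_of D}"
  using assms rel_frontier_of_polyhedron[OF polytope_imp_polyhedron[OF assms(2)]]
  by (simp add: convex_body_def rel_frontier_nonempty_interior)

subsection \<open>Homothets close to a side\<close>

lemma frame_box_homothety:
  assumes "\<mu> > 0" "frame_box d s s' t t' \<subseteq> C"
  shows "frame_box d (\<mu> * s + d \<bullet> v) (\<mu> * s' + d \<bullet> v)
      (\<mu> * t + left_normal d \<bullet> v) (\<mu> * t' + left_normal d \<bullet> v) \<subseteq> (\<lambda>x. \<mu> *\<^sub>R x + v) ` C"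
proof
  fix x assume x: "x \<in> frame_box d (\<mu> * s + d \<bullet> v) (\<mu> * s' + d \<bullet> v)
      (\<mu> * t + left_normal d \<bullet> v) (\<mu> * t' + left_normal d \<bullet> v)"
  let ?y = "(1 / \<mu>) *\<^sub>R (x - v)"
  have "?y \<in> frame_box d s s' t t'"
    using x assms(1) by (auto simp: frame_box_def inner_diff_right field_simps)
  then have "?y \<in> C" using assms(2) by blast
  moreover have "x = \<mu> *\<^sub>R ?y + v" using assms(1) by simp
  ultimately show "x \<in> (\<lambda>x. \<mu> *\<^sub>R x + v) ` C" by (rule rev_image_eqI)
qed

lemma frame_point_in_box:
  assumes "norm d = 1" "\<sigma> \<in> {s..s'}" "\<tau> \<in> {t..t'}"
  shows "frame_point d \<sigma> \<tau> \<in> frame_box d s s' t t'"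
  using assms by (simp add: frame_box_def inner_frame_point)

lemma frame_point_in_interior:
  assumes "norm d = 1" "s < \<sigma>" "\<sigma> < s'" "t < \<tau>" "\<tau> < t'" "frame_box d s s' t t' \<subseteq> K"
  shows "frame_point d \<sigma> \<tau> \<in> interior K"
proof (rule interiorI)
  let ?U = "{x. d \<bullet> x > s} \<inter> {x. d \<bullet> x < s'} \<inter> ({x. left_normal d \<bullet> x > t} \<inter> {x. left_normal d \<bullet> x < t'})"
  show "open ?U"
    by (intro open_Int open_halfspace_gt open_halfspace_lt)
  show "frame_point d \<sigma> \<tau> \<in> ?U"
    using assms by (simp add: inner_frame_point)
  have "?U \<subseteq> frame_box d s s' t t'"
    by (auto simp: frame_box_def)
  then show "?U \<subseteq> K" using assms(6) by blast
qed

text \<open>The lengths are Lebesgue measures of disjoint sets inside \<open>{p..q}\<close>.\<close>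

lemma sum_disjoint_intervals_le:
  fixes l u :: "'a \<Rightarrow> real"
  assumes "finite T" and lu: "\<And>K. K \<in> T \<Longrightarrow> l K \<le> u K \<and> {l K<..<u K} \<subseteq> {p..q}"
    and disj: "\<And>K L. K \<in> T \<Longrightarrow> L \<in> T \<Longrightarrow> K \<noteq> L \<Longrightarrow> {l K<..<u K} \<inter> {l L<..<u L} = {}"
    and "p \<le> q"
  shows "(\<Sum>K\<in>T. u K - l K) \<le> q - p"
proof -
  have "(\<Sum>K\<in>T. u K - l K) = (\<Sum>K\<in>T. measure lborel {l K<..<u K})"
    using lu by (intro sum.cong) auto
  also have "\<dots> = measure lborel (\<Union>K\<in>T. {l K<..<u K})"
    using assms by (intro measure_finite_Union[symmetric])
      (auto simp: disjoint_family_on_def)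
  also have "\<dots> \<le> measure lborel {p..q}"
    using lu by (intro measure_mono_fmeasurable)
      (auto intro!: sets.finite_UN fmeasurableI \<open>finite T\<close> simp: emeasure_lborel_Icc_eq)
  finally show ?thesis using \<open>p \<le> q\<close> by simp
qed

section \<open>Scales of homothets along one side\<close>

text \<open>Later \<open>b\<close> is the height of the line carrying a facet, \<open>{p..q}\<close>
  contains the extent of \<open>D\<close> along it, and the box comes from \<open>side_box\<close>
  for the parallel side of \<open>C\<close>.\<close>

locale side_frame =
  fixes C D :: "plane set" and d :: plane and b p q s s' m h :: real
  assumes norm_d: "norm d = 1"
    and D_above: "\<And>x. x \<in> D \<Longrightarrow> b \<le> left_normal d \<bullet> x"
    and D_width: "\<And>x. x \<in> D \<Longrightarrow> d \<bullet> x \<in> {p..q}" and pq: "p \<le> q"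
    and ss: "s < s'" and h: "h > 0" and box: "frame_box d s s' m (m + h) \<subseteq> C"
begin

text \<open>Two bodies whose boxes overlap in the direction of the side lie above each other, so the lower
  one fits between the side and the upper one, whose distance from the side is small relative to
  its size.\<close>

lemma comparable_sum_le:
  assumes "finite T" and A: "A > 0"
    and hom: "\<And>K. K \<in> T \<Longrightarrow> \<mu> K > 0 \<and> K = (\<lambda>x. \<mu> K *\<^sub>R x + v K) ` C \<and> K \<subseteq> D"
    and disj: "\<And>K L. K \<in> T \<Longrightarrow> L \<in> T \<Longrightarrow> K \<noteq> L \<Longrightarrow> interior K \<inter> interior L = {}"
    and near: "\<And>K. K \<in> T \<Longrightarrow> \<mu> K * m + left_normal d \<bullet> v K - b < h * \<mu> K / A"
    and comparable: "\<And>K L. K \<in> T \<Longrightarrow> L \<in> T \<Longrightarrow> \<mu> K \<le> A * \<mu> L"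
  shows "(\<Sum>K\<in>T. \<mu> K) \<le> (q - p) / (s' - s)"
proof -
  define l u t where "l K = \<mu> K * s + d \<bullet> v K" and "u K = \<mu> K * s' + d \<bullet> v K"
    and "t K = \<mu> K * m + left_normal d \<bullet> v K" for K
  have boxK: "frame_box d (l K) (u K) (t K) (t K + \<mu> K * h) \<subseteq> K" if "K \<in> T" for K
    using frame_box_homothety[OF _ box, of "\<mu> K" "v K"] hom[OF that]
    by (simp add: l_def u_def t_def algebra_simps)
  have lu: "l K < u K" if "K \<in> T" for K
    using hom[OF that] ss by (simp add: l_def u_def)
  have low: "frame_point d \<sigma> (t K) \<in> K" if "K \<in> T" "\<sigma> \<in> {l K..u K}" for K \<sigma>
    using frame_point_in_box[OF norm_d that(2), of "t K" "t K" "t K + \<mu> K * h"] hom[OF that(1)] h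
      boxK[OF that(1)] by auto
  have t_ge: "b \<le> t K" if "K \<in> T" for K
    using D_above[of "frame_point d (l K) (t K)"] low[OF that, of "l K"] lu[OF that] hom[OF that]
    by (auto simp: inner_frame_point norm_d)
  \<comment> \<open>If the box of \<open>K\<close> lay below that of \<open>L\<close>, its height
    would fit between the side and \<open>L\<close>, so nearness of \<open>L\<close> would force
    \<open>\<mu> L > A * \<mu> K\<close>.\<close>
  have wlog: "\<not> t K + \<mu> K * h \<le> t L" if "K \<in> T" "L \<in> T" for K L
  proof
    assume "t K + \<mu> K * h \<le> t L"
    then have "\<mu> K * h < h * \<mu> L / A"
      using near[OF that(2)] t_ge[OF that(1)] by (simp add: t_def)
    then have "h * (A * \<mu> K) < h * \<mu> L"
      using A by (simp add: field_simps)
    then have "A * \<mu> K < \<mu> L" using h by simp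
    then show False using comparable[OF that(2,1)] by simp
  qed
  have "(\<Sum>K\<in>T. u K - l K) \<le> q - p"
  proof (rule sum_disjoint_intervals_le[OF \<open>finite T\<close> _ _ pq])
    fix K assume K: "K \<in> T"
    have "\<sigma> \<in> {p..q}" if "\<sigma> \<in> {l K<..<u K}" for \<sigma>
      using D_width[of "frame_point d \<sigma> (t K)"] low[OF K, of \<sigma>] that hom[OF K]
      by (auto simp: inner_frame_point norm_d)
    then show "l K \<le> u K \<and> {l K<..<u K} \<subseteq> {p..q}"
      using lu[OF K] by auto
  next
    fix K L assume KL: "K \<in> T" "L \<in> T" "K \<noteq> L"
    show "{l K<..<u K} \<inter> {l L<..<u L} = {}"
    proof (rule ccontr)
      assume "{l K<..<u K} \<inter> {l L<..<u L} \<noteq> {}"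
      then obtain \<sigma> where "\<sigma> \<in> {l K<..<u K} \<inter> {l L<..<u L}" by blast
      then have \<sigma>: "l K < \<sigma>" "\<sigma> < u K" "l L < \<sigma>" "\<sigma> < u L" by auto
      have "0 < \<mu> K * h" "0 < \<mu> L * h" using hom KL h by auto
      \<comment> \<open>Neither box lies above the other, so their height ranges share an open
        interval; with the common \<open>\<sigma>\<close> this yields a common interior
        point.\<close>
      then have "max (t K) (t L) < min (t K + \<mu> K * h) (t L + \<mu> L * h)"
        using wlog[OF KL(1,2)] wlog[OF KL(2,1)] by simp
      then obtain \<tau> where "max (t K) (t L) < \<tau>" "\<tau> < min (t K + \<mu> K * h) (t L + \<mu> L * h)"
        using dense by blast
      then have "frame_point d \<sigma> \<tau> \<in> interior K" "frame_point d \<sigma> \<tau> \<in> interior L"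
        using \<sigma> by (auto intro!: frame_point_in_interior[OF norm_d _ _ _ _ boxK] KL)
      then show False using disj[OF KL] by blast
    qed
  qed
  also have "(\<Sum>K\<in>T. u K - l K) = (\<Sum>K\<in>T. \<mu> K) * (s' - s)"
    by (simp add: l_def u_def sum_distrib_right right_diff_distrib sum_subtractf)
  finally show ?thesis using ss by (simp add: pos_le_divide_eq)
qed

text \<open>The sizes between \<open>M / N\<close> and \<open>M\<close> are split into geometric classes of ratio \<open>A\<close>.\<close>

lemma near_sum_le:
  assumes "finite T" and A: "A > 1" and M: "M > 0" and N: "N \<ge> 1"
    and hom: "\<And>K. K \<in> T \<Longrightarrow> \<mu> K > 0 \<and> K = (\<lambda>x. \<mu> K *\<^sub>R x + v K) ` C \<and> K \<subseteq> D"
    and disj: "\<And>K L. K \<in> T \<Longrightarrow> L \<in> T \<Longrightarrow> K \<noteq> L \<Longrightarrow> interior K \<inter> interior L = {}"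
    and near: "\<And>K. K \<in> T \<Longrightarrow> \<mu> K * m + left_normal d \<bullet> v K - b < h * \<mu> K / A"
    and size: "\<And>K. K \<in> T \<Longrightarrow> \<mu> K \<in> {M / N..M}"
  shows "(\<Sum>K\<in>T. \<mu> K) \<le> (log A N + 1) * ((q - p) / (s' - s))"
proof -
  \<comment> \<open>Equal indices mean that the logarithms differ by less than 1, so the scales
    compare up to the factor \<open>A\<close>. The indices \<open>0\<close> to \<open>J\<close> give
    \<open>J + 1\<close> classes.\<close>
  define cls where "cls K = nat \<lfloor>log A (M / \<mu> K)\<rfloor>" for K
  define J where "J = nat \<lfloor>log A N\<rfloor>"
  have ratio: "1 \<le> M / \<mu> K" "M / \<mu> K \<le> N" if "K \<in> T" for K
    using size[OF that] hom[OF that] N M by (auto simp: field_simps)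
  have log0: "0 \<le> log A (M / \<mu> K)" if "K \<in> T" for K
    using ratio[OF that] A by simp
  have cls_le: "cls K \<in> {..J}" if "K \<in> T" for K
    using ratio[OF that] A by (auto simp: cls_def J_def intro!: nat_mono floor_mono)
  have "(\<Sum>K\<in>T. \<mu> K) = (\<Sum>j\<in>{..J}. \<Sum>K\<in>{K \<in> T. cls K = j}. \<mu> K)"
    using cls_le by (intro sum.group[symmetric] \<open>finite T\<close>) auto
  also have "\<dots> \<le> (\<Sum>j\<in>{..J}. (q - p) / (s' - s))"
  proof (intro sum_mono comparable_sum_le[where A = A and v = v])
    fix j K L assume K: "K \<in> {K \<in> T. cls K = j}" and L: "L \<in> {K \<in> T. cls K = j}"
    then have "\<lfloor>log A (M / \<mu> K)\<rfloor> = \<lfloor>log A (M / \<mu> L)\<rfloor>"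
      using log0[of K] log0[of L] by (auto simp: cls_def nat_eq_iff)
    then have "log A (M / \<mu> L) < log A (M / \<mu> K) + 1"
      by linarith
    also have "\<dots> = log A (M / \<mu> K * A)"
      using ratio[of K] K A by (subst log_mult) auto
    finally have lt: "log A (M / \<mu> L) < log A (M / \<mu> K * A)" .
    have "0 < M / \<mu> L" "0 < M / \<mu> K * A"
      using ratio[of K] ratio[of L] K L A by (auto intro!: mult_pos_pos simp del: times_divide_eq_left)
    then have "M / \<mu> L < M / \<mu> K * A"
      using lt A by (simp only: log_less_cancel_iff)
    then show "\<mu> K \<le> A * \<mu> L"
      using hom[of K] hom[of L] K L M by (simp add: field_simps)
  qed (use assms in auto)
  also have "\<dots> = (real J + 1) * ((q - p) / (s' - s))"
    by simp
  also have "\<dots> \<le> (log A N + 1) * ((q - p) / (s' - s))"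
    using A N pq ss by (intro mult_right_mono) (auto simp: J_def)
  finally show ?thesis .
qed

end

text \<open>Here \<open>h\<close> and \<open>c\<close> are fixed before the family and the
  parameters \<open>A\<close>, \<open>M\<close>, \<open>N\<close>, so one choice per facet serves
  all packings. Parallelism supplies the side of \<open>C\<close> on which the box stands.\<close>

lemma facet_sum_le:
  assumes C: "convex_body C" and D: "convex_body D" "polytope D" "parallel_to D C" and F: "F facet_of D"
  shows "\<exists>h>0. \<exists>c\<ge>0. \<forall>T \<mu> v A M N. finite T \<longrightarrow> A > 1 \<longrightarrow> M > 0 \<longrightarrow> N \<ge> 1 \<longrightarrow>
    (\<forall>K\<in>T. \<mu> K > 0 \<and> K = (\<lambda>x. \<mu> K *\<^sub>R x + v K) ` C \<and> K \<subseteq> D) \<longrightarrow>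
    pairwise (\<lambda>K L. interior K \<inter> interior L = {}) T \<longrightarrow>
    (\<forall>K\<in>T. \<exists>x\<in>K. \<exists>y\<in>F. dist x y < h * \<mu> K / A) \<longrightarrow>
    (\<forall>K\<in>T. \<mu> K \<in> {M / N..M}) \<longrightarrow>
    (\<Sum>K\<in>T. \<mu> K) \<le> c * (log A N + 1)"
proof -
  obtain d b where d: "norm d = 1" "has_side d D" "\<forall>x\<in>D. b \<le> left_normal d \<bullet> x"
    "F = D \<inter> {x. left_normal d \<bullet> x = b}"
    using facet_supporting_frame[OF D(1,2) F] by metis
  then have "has_side d C" using D(3) by (simp add: parallel_to_def)
  then obtain s s' m h where side: "s < s'" "h > 0" "\<forall>x\<in>C. m \<le> left_normal d \<bullet> x"
    "frame_box d s s' m (m + h) \<subseteq> C"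
    using side_box[OF C d(1)] by metis
  have "bounded D" using D(1) compact_imp_bounded by (auto simp: convex_body_def)
  then obtain R where R: "\<And>x. x \<in> D \<Longrightarrow> norm x \<le> R"
    by (auto simp: bounded_iff)
  have DR: "d \<bullet> x \<in> {-\<bar>R\<bar>..\<bar>R\<bar>}" if "x \<in> D" for x
    using Cauchy_Schwarz_ineq2[of d x] d(1) R[OF that] by auto
  interpret side_frame C D d b "-\<bar>R\<bar>" "\<bar>R\<bar>" s s' m h
    using d side DR by unfold_locales auto
  have "(\<Sum>K\<in>T. \<mu> K) \<le> (\<bar>R\<bar> - - \<bar>R\<bar>) / (s' - s) * (log A N + 1)"
    if "finite T" "A > 1" "M > 0" "N \<ge> 1"
      and hom: "\<forall>K\<in>T. \<mu> K > 0 \<and> K = (\<lambda>x. \<mu> K *\<^sub>R x + v K) ` C \<and> K \<subseteq> D"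
      and disj: "pairwise (\<lambda>K L. interior K \<inter> interior L = {}) T"
      and near: "\<forall>K\<in>T. \<exists>x\<in>K. \<exists>y\<in>F. dist x y < h * \<mu> K / A"
      and size: "\<forall>K\<in>T. \<mu> K \<in> {M / N..M}" for T \<mu> v A M N
  proof -
    have "(\<Sum>K\<in>T. \<mu> K) \<le> (log A N + 1) * ((\<bar>R\<bar> - - \<bar>R\<bar>) / (s' - s))"
    proof (rule near_sum_le[where v = v and M = M])
      fix K assume K: "K \<in> T"
      obtain x y where xy: "x \<in> K" "y \<in> F" "dist x y < h * \<mu> K / A"
        using near K by blast
      obtain c where c: "c \<in> C" "x = \<mu> K *\<^sub>R c + v K"
        using hom K xy(1) by blast
      \<comment> \<open>Since \<open>m\<close> is a lower bound for heights in \<open>C\<close>, the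
        base of the box is no higher than \<open>x\<close>, whose height over the side is at most
        \<open>dist x y\<close>.\<close>
      have "\<mu> K * m \<le> \<mu> K * (left_normal d \<bullet> c)"
        using hom K side(3) c(1) by (intro mult_left_mono) auto
      then have "\<mu> K * m + left_normal d \<bullet> v K - b \<le> left_normal d \<bullet> (x - y)"
        using xy(2) unfolding d(4) by (simp add: c(2) inner_right_distrib inner_diff_right)
      also have "\<dots> \<le> dist x y"
        using norm_cauchy_schwarz[of "left_normal d" "x - y"] d(1) by (simp add: dist_norm)
      also note xy(3)
      finally show "\<mu> K * m + left_normal d \<bullet> v K - b < h * \<mu> K / A" .
    qed (use that in \<open>auto simp: pairwise_def\<close>)
    then show ?thesis by (simp only: mult.commute)
  qed
  note le = this
  have "(\<bar>R\<bar> - - \<bar>R\<bar>) / (s' - s) \<ge> 0" using side by simp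
  then show ?thesis
    by (intro exI[of _ h] exI[of _ "(\<bar>R\<bar> - - \<bar>R\<bar>) / (s' - s)"] conjI allI impI side(2) le)
qed

subsection \<open>The upper bound\<close>

lemma sum_UN_le:
  fixes f :: "'a \<Rightarrow> real"
  assumes "finite I" "\<And>i. i \<in> I \<Longrightarrow> finite (A i)" "\<And>i x. i \<in> I \<Longrightarrow> x \<in> A i \<Longrightarrow> f x \<ge> 0"
  shows "sum f (\<Union>i\<in>I. A i) \<le> (\<Sum>i\<in>I. sum f (A i))"
  using assms
proof (induction I rule: finite_induct)
  case (insert i I)
  have "sum f (A i \<union> (\<Union>i\<in>I. A i)) \<le> sum f (A i) + sum f (\<Union>i\<in>I. A i)"
    using insert.hyps insert.prems by (subst sum_Un) (auto intro!: sum_nonneg)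
  then show ?case using insert by force
qed simp

section \<open>Estimates for logarithms and iterated logarithms\<close>

text \<open>The tangent bound is used at \<open>x / 2\<close>: it leaves
  \<open>ln x \<le> x / 2\<close>, and \<open>ln 2\<close> exceeds one half.\<close>

lemma log2_le_self:
  fixes x :: real
  assumes "x > 0"
  shows "log 2 x \<le> x"
proof -
  have "ln x = ln (x / 2) + ln 2" using assms by (simp add: ln_div)
  also have "\<dots> \<le> x / 2 - 1 + 1"
    using ln_le_minus_one[of "x / 2"] ln_le_minus_one[of 2] assms by simp
  also have "\<dots> \<le> x * ln 2"
    using ln2_ge_two_thirds assms by (simp add: field_simps)
  finally show ?thesis by (simp add: log_def field_simps)
qed

abbreviation log_ratio :: "nat \<Rightarrow> real" where
  "log_ratio n \<equiv> log 2 (real n) / log 2 (log 2 (real n))"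

text \<open>This is \<open>8 \<le> 9\<close> after squaring. It keeps the iterated logarithm
  positive already from \<open>n = 3\<close> on.\<close>

lemma log2_ge_3_half:
  assumes "n \<ge> 3"
  shows "log 2 (real n) \<ge> 3 / 2"
proof -
  have "(2 powr (3/2)) ^ 2 = 2 powr (3::real)"
    by (simp add: powr_power)
  also have "\<dots> \<le> 3 ^ 2" by simp
  finally have "2 powr (3/2) \<le> (3::real)"
    by (rule power2_le_imp_le) simp
  also have "3 \<le> real n" using assms by simp
  finally show ?thesis using assms by (subst le_log_iff) auto
qed

lemma log_log_pos:
  assumes "n \<ge> 3"
  shows "log 2 (log 2 (real n)) > 0"
  using log2_ge_3_half[OF assms] by simp

lemma log_ratio_ge_1:
  assumes "n \<ge> 3"
  shows "log_ratio n \<ge> 1"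
  using log2_le_self[of "log 2 (real n)"] log_log_pos[OF assms] log2_ge_3_half[OF assms] by simp

lemma log2_sqrt: "y > 0 \<Longrightarrow> log 2 (sqrt y) = log 2 y / 2"
  by (simp add: log_def ln_sqrt)

text \<open>Counts the geometric classes when the ratio is the square root of
  \<open>log 2 n\<close>.\<close>

lemma log_sqrt_log:
  assumes "n \<ge> 3"
  shows "log (sqrt (log 2 (real n))) (real n) = 2 * log_ratio n"
proof -
  let ?y = "log 2 (real n)"
  have "log 2 (sqrt ?y) = log 2 ?y / 2"
    using log2_ge_3_half[OF assms] by (intro log2_sqrt) auto
  moreover have "log (sqrt ?y) n = ?y / log 2 (sqrt ?y)"
    using log2_ge_3_half[OF assms] assms by (intro log_base_change) auto
  ultimately have "log (sqrt ?y) n = ?y / (log 2 ?y / 2)" by (simp only:)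
  then show ?thesis by simp
qed

text \<open>Applying \<open>log2_le_self\<close> to the square root of \<open>y\<close> gives
  \<open>log 2 y \<le> 2 * sqrt y\<close>. This is the cost of paying for a body by its escape
  distance.\<close>

lemma sqrt_log_le:
  assumes "n \<ge> 3"
  shows "sqrt (log 2 (real n)) \<le> 2 * log_ratio n"
proof -
  let ?y = "log 2 (real n)"
  have y: "?y > 1" using log2_ge_3_half[OF assms] by simp
  have "log 2 ?y = 2 * log 2 (sqrt ?y)"
    using y by (subst log2_sqrt) auto
  also have "\<dots> \<le> 2 * sqrt ?y"
    using log2_le_self[of "sqrt ?y"] y by simp
  finally have "sqrt ?y * log 2 ?y \<le> sqrt ?y * (2 * sqrt ?y)"
    using y by (intro mult_left_mono) auto
  also have "\<dots> = 2 * ?y" using y by simp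
  finally show ?thesis
    using log_log_pos[OF assms] by (simp add: pos_le_divide_eq)
qed

text \<open>As \<open>D\<close> is bounded and nonempty, its frontier is nonempty, so
  \<open>setdist\<close> is a genuine distance and not its default 0.\<close>

lemma esc_attained:
  assumes "convex_body K" "convex_body D"
  obtains x y where "x \<in> K" "y \<in> frontier D" "dist x y = esc D K"
proof -
  have "K \<noteq> {}" "compact K" using assms(1) by (auto simp: convex_body_def)
  moreover have "D \<noteq> UNIV"
    using assms(2) compact_imp_bounded not_bounded_UNIV unfolding convex_body_def by metis
  moreover have "D \<noteq> {}" using assms(2) by (auto simp: convex_body_def)
  ultimately obtain x y where "x \<in> K" "y \<in> frontier D" "dist x y = setdist K (frontier D)"
    using setdist_compact_closed[of K "frontier D"] by (auto simp: frontier_eq_empty)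
  then show thesis using that by (simp add: esc_def)
qed

text \<open>The homothet contains two points at distance \<open>\<mu> * e\<close>, while distances
  in \<open>D\<close> are at most \<open>2 * R\<close>.\<close>

lemma homothet_scale_bound:
  assumes "convex_body C" "convex_body D"
  obtains M where "M > 0" "\<And>\<mu> v. \<mu> > 0 \<Longrightarrow> (\<lambda>x. \<mu> *\<^sub>R x + v) ` C \<subseteq> D \<Longrightarrow> \<mu> \<le> M"
proof -
  obtain c e where c: "e > 0" "cball c e \<subseteq> C"
    using assms(1) mem_interior_cball unfolding convex_body_def by blast
  have "bounded D" using assms(2) compact_imp_bounded by (auto simp: convex_body_def)
  then obtain R where R: "R > 0" "\<forall>x\<in>D. norm x \<le> R"
    by (auto simp: bounded_pos)
  obtain w :: plane where w: "norm w = e" using vector_choose_size c by (metis less_imp_le)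
  have "\<mu> \<le> 2 * R / e" if \<mu>: "\<mu> > 0" "(\<lambda>x. \<mu> *\<^sub>R x + v) ` C \<subseteq> D" for \<mu> v
  proof -
    have "c \<in> C" "c + w \<in> C"
      using c w by (auto simp: dist_norm intro!: subsetD[OF c(2)])
    then have "norm (\<mu> *\<^sub>R c + v) \<le> R" "norm (\<mu> *\<^sub>R (c + w) + v) \<le> R"
      using \<mu>(2) R(2) by auto
    then have "norm ((\<mu> *\<^sub>R (c + w) + v) - (\<mu> *\<^sub>R c + v)) \<le> R + R"
      by (meson add_mono norm_triangle_ineq4 order_trans)
    then have "\<mu> * e \<le> 2 * R"
      using \<mu>(1) w by (simp add: scaleR_add_right)
    then show ?thesis using c by (simp add: pos_le_divide_eq)
  qed
  then show thesis using that[of "2 * R / e"] c R by simp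
qed

theorem perimeter_upper_bound:
  assumes C: "convex_body C" and D: "convex_body D" "polytope D" "parallel_to D C"
  shows "\<exists>\<rho>>0. \<forall>n\<ge>3. \<forall>S.
            packing S D \<and> card S = n \<and> (\<forall>K\<in>S. positive_homothet C K) \<longrightarrow>
            (\<Sum>K\<in>S. perimeter K) \<le> \<rho> * (perimeter D + (\<Sum>K\<in>S. esc D K)) * log_ratio n"
proof -
  define \<F> where "\<F> = {F. F facet_of D}"
  have fin: "finite \<F>"
    using D(2) finite_polytope_facets by (simp add: \<F>_def)
  define good where "good h c F \<longleftrightarrow> (\<forall>T \<mu> v A M N. finite T \<longrightarrow> A > 1 \<longrightarrow> M > 0 \<longrightarrow> N \<ge> 1 \<longrightarrow>
    (\<forall>K\<in>T. \<mu> K > 0 \<and> K = (\<lambda>x. \<mu> K *\<^sub>R x + v K) ` C \<and> K \<subseteq> D) \<longrightarrow>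
    pairwise (\<lambda>K L. interior K \<inter> interior L = {}) T \<longrightarrow>
    (\<forall>K\<in>T. \<exists>x\<in>K. \<exists>y\<in>F. dist x y < h * \<mu> K / A) \<longrightarrow>
    (\<forall>K\<in>T. \<mu> K \<in> {M / N..M}) \<longrightarrow>
    (\<Sum>K\<in>T. \<mu> K) \<le> c * (log A N + 1))" for h c F
  have "\<exists>h>0. \<exists>c\<ge>0. good h c F" if "F \<in> \<F>" for F
    using that unfolding good_def \<F>_def by (intro facet_sum_le[OF C D]) simp
  then have "\<forall>F\<in>\<F>. \<exists>h c. h > 0 \<and> c \<ge> 0 \<and> good h c F" by blast
  then obtain h where "\<forall>F\<in>\<F>. \<exists>c. h F > 0 \<and> c \<ge> 0 \<and> good (h F) c F"
    unfolding bchoice_iff by blast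
  then obtain c where hc: "\<forall>F\<in>\<F>. h F > 0 \<and> c F \<ge> 0 \<and> good (h F) (c F) F"
    unfolding bchoice_iff by blast
  \<comment> \<open>The element 1 keeps the set nonempty. Replacing \<open>h F\<close> by the
    smaller \<open>h0\<close> only strengthens the nearness condition.\<close>
  define h0 where "h0 = Min (insert 1 (h ` \<F>))"
  define c0 where "c0 = (\<Sum>F\<in>\<F>. c F)"
  have h0: "h0 > 0" using hc fin by (simp add: h0_def)
  have h0_le: "h0 \<le> h F" if "F \<in> \<F>" for F using that fin by (simp add: h0_def)
  have c0: "c0 \<ge> 0" using hc by (auto simp: c0_def intro: sum_nonneg)
  obtain M where M: "M > 0" "\<And>\<mu> v. \<mu> > 0 \<Longrightarrow> (\<lambda>x. \<mu> *\<^sub>R x + v) ` C \<subseteq> D \<Longrightarrow> \<mu> \<le> M"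
    using homothet_scale_bound[OF C D(1)] by blast
  \<comment> \<open>\<open>M\<close> pays for the tiny bodies and \<open>3 * c0\<close> for the near
    ones, both charged to the perimeter of \<open>D\<close>; \<open>2 / h0\<close> pays for the far
    ones, charged to escape distance.\<close>
  define \<rho> where "\<rho> = perimeter C * ((M + 3 * c0) / perimeter D + 2 / h0)"
  have per: "perimeter C > 0" "perimeter D > 0"
    using perimeter_pos C D by auto
  have "\<rho> > 0"
    using per h0 c0 M(1) by (auto simp: \<rho>_def intro!: mult_pos_pos add_nonneg_pos)
  moreover have "(\<Sum>K\<in>S. perimeter K) \<le> \<rho> * (perimeter D + (\<Sum>K\<in>S. esc D K)) * log_ratio n"
    if n: "n \<ge> 3" and S: "packing S D" "card S = n" and "\<forall>K\<in>S. positive_homothet C K" for n S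
  proof -
    have "\<forall>K\<in>S. \<exists>\<mu> v. \<mu> > 0 \<and> K = (\<lambda>x. \<mu> *\<^sub>R x + v) ` C"
      using that(4) unfolding positive_homothet_def .
    then obtain \<mu> where "\<forall>K\<in>S. \<exists>v. \<mu> K > 0 \<and> K = (\<lambda>x. \<mu> K *\<^sub>R x + v) ` C"
      unfolding bchoice_iff by blast
    then obtain v where hom: "\<forall>K\<in>S. \<mu> K > 0 \<and> K = (\<lambda>x. \<mu> K *\<^sub>R x + v K) ` C"
      unfolding bchoice_iff by blast
    have finS: "finite S" and sub: "\<And>K. K \<in> S \<Longrightarrow> convex_body K \<and> K \<subseteq> D"
      and disj: "pairwise (\<lambda>K L. interior K \<inter> interior L = {}) S"
      using S(1) by (auto simp: packing_def)
    define L where "L = log_ratio n"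
    let ?E = "\<Sum>K\<in>S. esc D K"
    have L1: "L \<ge> 1" unfolding L_def by (rule log_ratio_ge_1[OF n])
    define A where "A = sqrt (log 2 (real n))"
    have A: "A > 1" "A \<le> 2 * L"
      using log2_ge_3_half[OF n] sqrt_log_le[OF n] by (auto simp: A_def L_def)
    have \<mu>_pos: "\<mu> K > 0" if "K \<in> S" for K using hom that by blast
    have \<mu>_le: "\<mu> K \<le> M" if "K \<in> S" for K
      using M(2)[of "\<mu> K" "v K"] hom sub that by metis
    have esc0: "esc D K \<ge> 0" for K by (simp add: esc_def setdist_pos_le)
    define tiny where "tiny = {K \<in> S. \<mu> K < M / n}"
    define far where "far = {K \<in> S. h0 * \<mu> K / A \<le> esc D K}"
    define near where "near F = {K \<in> S. M / n \<le> \<mu> K \<and> (\<exists>x\<in>K. \<exists>y\<in>F. dist x y < h0 * \<mu> K / A)}" for F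
    \<comment> \<open>A frontier point nearest to \<open>K\<close> lies on some facet, and
      \<open>K\<close> is assigned to that facet.\<close>
    have "S \<subseteq> tiny \<union> far \<union> (\<Union>F\<in>\<F>. near F)"
    proof
      fix K assume K: "K \<in> S"
      obtain x y where xy: "x \<in> K" "y \<in> frontier D" "dist x y = esc D K"
        using esc_attained sub[OF K] D(1) by metis
      obtain F where "F \<in> \<F>" "y \<in> F"
        using xy(2) frontier_polytope_facets[OF D(1,2)] by (auto simp: \<F>_def)
      then show "K \<in> tiny \<union> far \<union> (\<Union>F\<in>\<F>. near F)"
        using K xy unfolding tiny_def far_def near_def by (cases "h0 * \<mu> K / A \<le> esc D K") force+
    qed
    have fins: "finite tiny" "finite far" "finite (near F)" for F
      using finS by (auto simp: tiny_def far_def near_def)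
    have tiny: "sum \<mu> tiny \<le> M"
    proof -
      have "sum \<mu> tiny \<le> real (card tiny) * (M / n)"
        by (rule sum_bounded_above) (auto simp: tiny_def)
      also have "\<dots> \<le> real n * (M / n)"
        using M(1) S(2) card_mono[OF finS, of tiny] by (intro mult_right_mono) (auto simp: tiny_def)
      finally show ?thesis using n by simp
    qed
    have far: "sum \<mu> far \<le> 2 / h0 * ?E * L"
    proof -
      have "sum \<mu> far \<le> (\<Sum>K\<in>far. A / h0 * esc D K)"
        using h0 A by (intro sum_mono) (auto simp: far_def field_simps)
      also have "\<dots> \<le> (\<Sum>K\<in>S. A / h0 * esc D K)"
        using finS esc0 h0 A by (intro sum_mono2) (auto simp: far_def)
      also have "\<dots> = A * (?E / h0)"
        by (simp add: sum_distrib_left sum_divide_distrib)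
      also have "\<dots> \<le> 2 * L * (?E / h0)"
        using A h0 esc0 by (intro mult_right_mono) (auto intro!: sum_nonneg divide_nonneg_pos)
      finally show ?thesis by (simp add: algebra_simps)
    qed
    have near: "sum \<mu> (near F) \<le> c F * (3 * L)" if F: "F \<in> \<F>" for F
    proof -
      have near_disj: "pairwise (\<lambda>K L. interior K \<inter> interior L = {}) (near F)"
        using disj by (rule pairwise_subset) (auto simp: near_def)
      have near_dist: "\<forall>K\<in>near F. \<exists>x\<in>K. \<exists>y\<in>F. dist x y < h F * \<mu> K / A"
      proof
        fix K assume K: "K \<in> near F"
        then obtain x y where xy: "x \<in> K" "y \<in> F" "dist x y < h0 * \<mu> K / A"
          by (auto simp: near_def)
        have "h0 * \<mu> K / A \<le> h F * \<mu> K / A"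
          using h0_le[OF F] \<mu>_pos[of K] K A(1)
          by (intro divide_right_mono mult_right_mono) (auto simp: near_def)
        then show "\<exists>x\<in>K. \<exists>y\<in>F. dist x y < h F * \<mu> K / A"
          using xy by (meson less_le_trans)
      qed
      have near_hom: "\<forall>K\<in>near F. \<mu> K > 0 \<and> K = (\<lambda>x. \<mu> K *\<^sub>R x + v K) ` C \<and> K \<subseteq> D"
        using hom sub by (auto simp: near_def simp del: image_subset_iff)
      have near_size: "\<forall>K\<in>near F. \<mu> K \<in> {M / real n..M}"
        using \<mu>_le by (auto simp: near_def)
      have "good (h F) (c F) F" using hc F by blast
      note this[unfolded good_def, THEN spec[of _ "near F"], THEN spec[of _ \<mu>], THEN spec[of _ v],
          THEN spec[of _ A], THEN spec[of _ M], THEN spec[of _ "real n"], THEN mp, THEN mp, THEN mp,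
          THEN mp, OF fins(3) A(1) M(1), THEN mp, THEN mp, THEN mp, THEN mp,
          OF _ near_hom near_disj near_dist near_size]
      then have "sum \<mu> (near F) \<le> c F * (log A n + 1)"
        using n by simp
      \<comment> \<open>The class count is \<open>2 * L + 1\<close>, and
        \<open>L \<ge> 1\<close>.\<close>
      also have "\<dots> \<le> c F * (3 * L)"
        using log_sqrt_log[OF n] L1 hc F by (intro mult_left_mono) (auto simp: A_def L_def)
      finally show ?thesis .
    qed
    have "sum \<mu> S \<le> sum \<mu> (tiny \<union> far \<union> (\<Union>F\<in>\<F>. near F))"
      using \<open>S \<subseteq> _\<close> fin fins \<mu>_pos
      by (intro sum_mono2) (auto simp: tiny_def far_def near_def less_imp_le)
    also have "\<dots> \<le> sum \<mu> (tiny \<union> far) + sum \<mu> (\<Union>F\<in>\<F>. near F)"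
      using fin fins \<mu>_pos
      by (subst sum_Un) (auto simp: tiny_def far_def near_def less_imp_le intro!: sum_nonneg)
    also have "sum \<mu> (tiny \<union> far) \<le> sum \<mu> tiny + sum \<mu> far"
      using fin fins \<mu>_pos
      by (subst sum_Un) (auto simp: tiny_def far_def near_def less_imp_le intro!: sum_nonneg)
    also have "sum \<mu> (\<Union>F\<in>\<F>. near F) \<le> (\<Sum>F\<in>\<F>. sum \<mu> (near F))"
      using fin fins \<mu>_pos by (intro sum_UN_le) (auto simp: near_def less_imp_le)
    also have "(\<Sum>F\<in>\<F>. sum \<mu> (near F)) \<le> (\<Sum>F\<in>\<F>. c F * (3 * L))"
      using near by (rule sum_mono)
    also have "\<dots> = c0 * (3 * L)"
      by (simp only: c0_def sum_distrib_right)
    also note tiny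
    also note far
    also have "M \<le> M * L" using mult_left_mono[OF L1, of M] M(1) by simp
    finally have sum\<mu>: "sum \<mu> S \<le> ((M + 3 * c0) + 2 / h0 * ?E) * L"
      by (simp add: algebra_simps)
    have "(\<Sum>K\<in>S. perimeter K) = (\<Sum>K\<in>S. \<mu> K * perimeter C)"
      using hom perimeter_homothety by (intro sum.cong) metis+
    also have "\<dots> = perimeter C * sum \<mu> S"
      by (simp add: mult.commute flip: sum_distrib_left)
    also have "\<dots> \<le> perimeter C * (((M + 3 * c0) + 2 / h0 * ?E) * L)"
      using per sum\<mu> by (intro mult_left_mono) auto
    \<comment> \<open>Expanding the product on the right reproduces the left side plus nonnegative
      cross terms.\<close>
    also have "\<dots> \<le> perimeter C * (((M + 3 * c0) / perimeter D + 2 / h0) * (perimeter D + ?E) * L)"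
    proof (intro mult_left_mono mult_right_mono)
      have "0 \<le> ?E" using esc0 by (intro sum_nonneg)
      then have "0 \<le> (M + 3 * c0) / perimeter D * ?E + 2 / h0 * perimeter D"
        using M(1) c0 h0 per by (intro add_nonneg_nonneg mult_nonneg_nonneg) auto
      moreover have "((M + 3 * c0) / perimeter D + 2 / h0) * (perimeter D + ?E)
        = (M + 3 * c0) + 2 / h0 * ?E + ((M + 3 * c0) / perimeter D * ?E + 2 / h0 * perimeter D)"
        using per(2) h0 by (simp add: field_simps)
      ultimately show "(M + 3 * c0) + 2 / h0 * ?E
        \<le> ((M + 3 * c0) / perimeter D + 2 / h0) * (perimeter D + ?E)" by linarith
    qed (use L1 per in auto)
    finally show ?thesis by (simp only: \<rho>_def L_def mult.assoc)
  qed
  ultimately show ?thesis by blast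
qed

subsection \<open>The lower bound\<close>

text \<open>With \<open>y = log 2 n\<close>, take \<open>A\<close> as \<open>y\<close> rounded up
  and \<open>k\<close> as \<open>log A n\<close> rounded down. From \<open>A \<le> y ^ 3\<close>
  follows \<open>log 2 A \<le> 3 * log 2 y\<close>, and rounding down loses at most a factor 2;
  together this is the 6.\<close>

lemma power_parameters:
  assumes "n \<ge> 3"
  obtains A k :: nat where "A \<ge> 2" "A ^ k \<le> n" "k \<le> A" "real k \<ge> log_ratio n / 6"
proof -
  define y where "y = log 2 (real n)"
  have y: "y \<ge> 3 / 2" using log2_ge_3_half[OF assms] by (simp add: y_def)
  define A where "A = nat \<lceil>y\<rceil>"
  have Ay: "y \<le> real A" "real A < y + 1"
    using y by (auto simp: A_def) linarith
  have A2: "A \<ge> 2" using Ay y by linarith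
  have "y \<le> real n" using log2_of_power_le[of n n] less_exp[of n] assms by (simp add: y_def less_imp_le)
  then have "A \<le> n" using Ay(2) by linarith
  define z where "z = log A n"
  have "z \<ge> 1" using A2 \<open>A \<le> n\<close> assms by (simp add: z_def)
  have logA: "log 2 A \<ge> 1" using A2 by simp
  have z_eq: "z = y / log 2 A"
    using A2 assms unfolding z_def y_def by (intro log_base_change) auto
  then have "z \<le> y" using divide_left_mono[of 1 "log 2 A" y] logA y by simp
  define k where "k = nat \<lfloor>z\<rfloor>"
  have k: "real k \<le> z" "z < real k + 1"
    using \<open>z \<ge> 1\<close> by (auto simp: k_def)
  have "real (A ^ k) = real A powr real k" using A2 by (simp add: powr_realpow)
  also have "\<dots> \<le> real A powr z" using A2 k by (intro powr_mono) auto
  also have "\<dots> = real n" using A2 assms by (simp add: z_def)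
  finally have 2: "A ^ k \<le> n" by simp
  have 3: "k \<le> A" using k Ay \<open>z \<le> y\<close> by linarith
  have "y + 1 \<le> y * (9 / 4)" using y by simp
  also have "\<dots> \<le> y * (y * y)" using y mult_mono[of "3/2" y "3/2" y] by (intro mult_left_mono) auto
  finally have "real A \<le> y ^ 3" using Ay by (simp add: power3_eq_cube)
  then have "log 2 A \<le> log 2 (y ^ 3)" using A2 y by (intro log_mono) auto
  also have "\<dots> = 3 * log 2 y" using y by (subst log_nat_power) auto
  finally have "y / (3 * log 2 y) \<le> z"
    unfolding z_eq using y logA by (intro divide_left_mono) (auto intro!: mult_pos_pos)
  moreover have "k \<ge> 1" using k \<open>z \<ge> 1\<close> by (cases k) auto
  then have "z \<le> 2 * real k" using k by linarith
  ultimately have "log_ratio n / 6 \<le> real k" by (simp add: y_def)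
  then show thesis using that A2 2 3 by blast
qed

lemma sum_powers_le:
  fixes A :: nat
  assumes "A \<ge> 2"
  shows "(\<Sum>j<k. A ^ j) \<le> A ^ k"
proof (induction k)
  case (Suc k)
  then have "(\<Sum>j<Suc k. A ^ j) \<le> 2 * A ^ k" by simp
  also have "\<dots> \<le> A ^ Suc k" using assms by simp
  finally show ?case .
qed simp

text \<open>Axis-parallel squares in the unit square, as side length, left end and height of the base. Row
  \<open>j\<close> consists of \<open>A ^ j\<close> squares of side \<open>1 / (4 A ^ j)\<close> and fits below row \<open>j - 1\<close>; since the
  height of a row is of the order of the next smaller side length, its squares have total height
  \<open>1 / (2 A)\<close>. The last row of tiny squares on the ground only adjusts the number.\<close>

lemma square_packing:
  assumes "n \<ge> 3"
  obtains J :: "(nat \<times> nat) set" and a s t :: "nat \<times> nat \<Rightarrow> real" where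
    "finite J" "card J = n"
    "\<And>x. x \<in> J \<Longrightarrow> 0 < a x \<and> 0 \<le> s x \<and> s x + a x \<le> 1 \<and> 0 \<le> t x \<and> t x + a x \<le> 1"
    "\<And>x y. x \<in> J \<Longrightarrow> y \<in> J \<Longrightarrow> x \<noteq> y \<Longrightarrow>
       s x + a x \<le> s y \<or> s y + a y \<le> s x \<or> t x + a x \<le> t y \<or> t y + a y \<le> t x"
    "(\<Sum>x\<in>J. t x) \<le> 1" "(\<Sum>x\<in>J. a x) \<ge> log_ratio n / 24"
proof -
  obtain A k where Ak: "A \<ge> 2" "A ^ k \<le> n" "k \<le> A" "real k \<ge> log_ratio n / 6"
    using power_parameters[OF assms] by metis
  define B :: "nat \<Rightarrow> real" where "B j = real A ^ j" for j
  have B1: "B j \<ge> 1" for j using Ak(1) by (simp add: B_def)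
  then have Bpos: "B j > 0" for j by (rule less_le_trans[OF zero_less_one])
  have B0: "B j \<noteq> 0" for j using Bpos[of j] by simp
  have Bmono: "B i \<le> B j" if "i \<le> j" for i j
    using that Ak(1) by (simp add: B_def power_increasing)
  have BSuc: "B (Suc j) = real A * B j" for j by (simp add: B_def)
  define r where "r = n - (\<Sum>j<k. A ^ j)"
  define cnt where "cnt j = (if j < k then A ^ j else r)" for j
  \<comment> \<open>In the last row the side is so small that up to \<open>n\<close> squares fit
    side by side and below every other row.\<close>
  define a where "a j = (if j < k then 1 / (4 * B j) else 1 / (4 * (B k * n)))" for j
  \<comment> \<open>Twice the side of the squares in row \<open>j + 1\<close>: one half holds these
    squares, the other half suffices for their own base height because
    \<open>A \<ge> 2\<close>.\<close>
  define t where "t j = (if j < k then 1 / (2 * B (Suc j)) else 0)" for j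
  define J where "J = (SIGMA j:{..k}. {..<cnt j})"
  have apos: "a j > 0" for j using Bpos assms by (simp add: a_def)
  have cnt_a: "real (cnt j) * a j \<le> 1 / 4" for j
  proof (cases "j < k")
    case False
    have "real r \<le> B k * n"
      using mult_mono[of 1 "B k" "real r" "real n"] B1[of k] by (simp add: r_def)
    then show ?thesis using False Bpos[of k] assms by (simp add: cnt_def a_def field_simps)
  qed (use Ak(1) in \<open>simp add: cnt_def a_def B_def\<close>)
  have row: "(real i + 1) * a j \<le> 1 / 4" if "i < cnt j" for i j
  proof -
    have "(real i + 1) * a j \<le> real (cnt j) * a j"
      using that apos[of j] by (intro mult_right_mono) auto
    then show ?thesis using cnt_a[of j] by linarith
  qed
  have t0: "t j \<ge> 0" for j using Bpos by (simp add: t_def less_imp_le)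
  have a_le: "a j \<le> 1 / 4" for j
  proof (cases "j < k")
    case False
    then show ?thesis
      using mult_mono[of 1 "B k" 1 "real n"] B1[of k] assms by (simp add: a_def field_simps)
  qed (use B1[of j] in \<open>simp add: a_def field_simps\<close>)
  have t_le: "t j \<le> 1 / 2" for j using B1[of "Suc j"] by (simp add: t_def field_simps)
  have below: "t j' + a j' \<le> t j" if "j < j'" "j' \<le> k" for j j'
  proof (cases "j' < k")
    case True
    have "t j' \<le> 1 / (4 * B j')"
      using True Ak(1) Bpos[of j'] by (simp add: t_def BSuc field_simps)
    then have "t j' + a j' \<le> 1 / (2 * B j')"
      using True by (simp add: a_def)
    also have "\<dots> \<le> 1 / (2 * B (Suc j))"
      using Bmono[of "Suc j" j'] that Bpos by (intro divide_left_mono) auto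
    finally show ?thesis using True that by (simp add: t_def)
  next
    case False
    have "B (Suc j) * 1 \<le> B k * n"
      using Bmono[of "Suc j" k] that assms Bpos[of k] by (intro mult_mono) auto
    then have "2 * B (Suc j) \<le> 4 * (B k * n)"
      using Bpos[of "Suc j"] by linarith
    then show ?thesis
      using False that assms Bpos[of "Suc j"] by (auto simp: t_def a_def intro!: divide_left_mono mult_pos_pos Bpos)
  qed
  have "card J = (\<Sum>j\<le>k. cnt j)" by (simp add: J_def)
  also have "\<dots> = (\<Sum>j<k. A ^ j) + r" by (simp add: lessThan_Suc_atMost[symmetric] cnt_def)
  also have "\<dots> = n" using sum_powers_le[OF Ak(1), of k] Ak(2) by (simp add: r_def)
  finally have cardJ: "card J = n" .
  have sumJ: "(\<Sum>x\<in>J. f (fst x)) = (\<Sum>j<k. B j * f j) + r * f k" for f :: "nat \<Rightarrow> real"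
  proof -
    have "(\<Sum>x\<in>J. f (fst x)) = (\<Sum>j\<le>k. \<Sum>i<cnt j. f j)"
      unfolding J_def by (subst sum.Sigma) (auto simp: case_prod_unfold)
    then show ?thesis by (simp add: lessThan_Suc_atMost[symmetric] cnt_def B_def)
  qed
  show thesis
  proof (rule that[of J "\<lambda>x. a (fst x)" "\<lambda>x. real (snd x) * a (fst x)" "\<lambda>x. t (fst x)"])
    show "finite J" by (simp add: J_def)
    show "card J = n" by (rule cardJ)
    fix x assume x: "x \<in> J"
    then have "(real (snd x) + 1) * a (fst x) \<le> 1 / 4" by (intro row) (auto simp: J_def)
    then show "0 < a (fst x) \<and> 0 \<le> real (snd x) * a (fst x) \<and> real (snd x) * a (fst x) + a (fst x) \<le> 1
      \<and> 0 \<le> t (fst x) \<and> t (fst x) + a (fst x) \<le> 1"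
      using apos[of "fst x"] t0[of "fst x"] t_le[of "fst x"] a_le[of "fst x"] by (auto simp: algebra_simps)
  next
    fix x y assume xy: "x \<in> J" "y \<in> J" "x \<noteq> y"
    consider "fst x < fst y" | "fst y < fst x" | "fst x = fst y" "snd x < snd y" | "fst x = fst y" "snd y < snd x"
      using xy(3) by (metis linorder_neqE_nat prod.expand)
    then show "real (snd x) * a (fst x) + a (fst x) \<le> real (snd y) * a (fst y) \<or>
       real (snd y) * a (fst y) + a (fst y) \<le> real (snd x) * a (fst x) \<or>
       t (fst x) + a (fst x) \<le> t (fst y) \<or> t (fst y) + a (fst y) \<le> t (fst x)"
    proof cases
      case 1
      then show ?thesis using below[of "fst x" "fst y"] xy by (auto simp: J_def)
    next
      case 2
      then show ?thesis using below[of "fst y" "fst x"] xy by (auto simp: J_def)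
    next
      case 3
      then have "(real (snd x) + 1) * a (fst x) \<le> real (snd y) * a (fst x)"
        using apos[of "fst x"] by (intro mult_right_mono) auto
      then show ?thesis using 3 by (simp add: algebra_simps)
    next
      case 4
      then have "(real (snd y) + 1) * a (fst x) \<le> real (snd x) * a (fst x)"
        using apos[of "fst x"] by (intro mult_right_mono) auto
      then show ?thesis using 4 by (simp add: algebra_simps)
    qed
  next
    \<comment> \<open>Each of the \<open>k\<close> full rows contributes \<open>1 / (2 * A)\<close>,
      the ground row nothing, and \<open>k \<le> A\<close>.\<close>
    have "(\<Sum>x\<in>J. t (fst x)) = (\<Sum>j<k. 1 / (2 * real A))"
      unfolding sumJ using B0 by (simp add: t_def BSuc)
    also have "\<dots> \<le> 1" using Ak(1,3) by (simp add: field_simps)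
    finally show "(\<Sum>x\<in>J. t (fst x)) \<le> 1" .
    \<comment> \<open>Each full row has total side length \<open>1 / 4\<close>.\<close>
    have "log_ratio n / 24 \<le> real k / 4" using Ak(4) by simp
    also have "\<dots> = (\<Sum>j<k. B j * a j)"
      using B0 by (simp add: a_def)
    also have "\<dots> \<le> (\<Sum>x\<in>J. a (fst x))"
      unfolding sumJ using apos[of k] by simp
    finally show "log_ratio n / 24 \<le> (\<Sum>x\<in>J. a (fst x))" .
  qed
qed

section \<open>Placing the homothets over a side\<close>

text \<open>Neighbouring boxes may share edges, so disjointness of interiors needs strict
  inequalities; they come from moving \<open>z\<close> by \<open>e\<close> along both axes.\<close>

lemma interior_frame_box_strict:
  assumes "norm d = 1" "K \<subseteq> frame_box d s s' t t'" "z \<in> interior K"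
  shows "s < d \<bullet> z \<and> d \<bullet> z < s' \<and> t < left_normal d \<bullet> z \<and> left_normal d \<bullet> z < t'"
proof -
  obtain e where e: "e > 0" "cball z e \<subseteq> K"
    using assms(3) mem_interior_cball by blast
  have mem: "z + c *\<^sub>R w \<in> frame_box d s s' t t'" if "norm w = 1" "\<bar>c\<bar> \<le> e" for c w
    using e(2) that assms(2) by (intro subsetD[OF assms(2)] subsetD[OF e(2)]) (simp add: dist_norm)
  have "d \<bullet> d = 1" using assms(1) by (simp add: norm_eq_1)
  then show ?thesis
    using mem[of d e] mem[of d "- e"] mem[of "left_normal d" e] mem[of "left_normal d" "- e"] e(1) assms(1)
    by (simp add: frame_box_def inner_right_distrib inner_diff_right)
qed

text \<open>The body touches the bottom of its bounding square at \<open>c0\<close>; this point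
  later bounds the escape distance.\<close>

lemma body_in_frame_box:
  assumes "convex_body C" "norm d = 1"
  obtains p u w c0 where "w > 0" "C \<subseteq> frame_box d p (p + w) u (u + w)" "c0 \<in> C" "left_normal d \<bullet> c0 = u"
proof -
  have "compact C" "C \<noteq> {}" using assms(1) by (auto simp: convex_body_def)
  moreover have "continuous_on C (\<lambda>x. left_normal d \<bullet> x)"
    by (intro continuous_intros)
  ultimately obtain c0 where c0: "c0 \<in> C" "\<forall>x\<in>C. left_normal d \<bullet> c0 \<le> left_normal d \<bullet> x"
    using continuous_attains_inf[of C] by blast
  obtain R where R: "R > 0" "\<forall>x\<in>C. norm x \<le> R"
    using \<open>compact C\<close> compact_imp_bounded bounded_pos by metis
  have abs: "\<bar>d \<bullet> x\<bar> \<le> R" "\<bar>left_normal d \<bullet> x\<bar> \<le> R" if "x \<in> C" for x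
    using Cauchy_Schwarz_ineq2[of d x] Cauchy_Schwarz_ineq2[of "left_normal d" x] R(2) that assms(2)
    by auto
  have "C \<subseteq> frame_box d (- R) (- R + 2 * R) (left_normal d \<bullet> c0) (left_normal d \<bullet> c0 + 2 * R)"
  proof
    fix x assume "x \<in> C"
    then show "x \<in> frame_box d (- R) (- R + 2 * R) (left_normal d \<bullet> c0) (left_normal d \<bullet> c0 + 2 * R)"
      using abs[of x] abs[of c0] c0 by (simp add: frame_box_def abs_le_iff)
  qed
  from that[OF _ this c0(1) refl] show thesis using R(1) by simp
qed

theorem perimeter_lower_bound:
  assumes C: "convex_body C" and D: "convex_body D" "polytope D"
  shows "\<exists>\<sigma>>0. \<forall>n\<ge>3. \<exists>S.
            packing S D \<and> card S = n \<and> (\<forall>K\<in>S. positive_homothet C K) \<and>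
            (\<Sum>K\<in>S. perimeter K) \<ge> \<sigma> * (perimeter D + (\<Sum>K\<in>S. esc D K)) * log_ratio n"
proof -
  have "frontier D \<noteq> {}"
    using esc_attained[OF D(1) D(1)] by blast
  then obtain F where "F facet_of D"
    unfolding frontier_polytope_facets[OF D] by blast
  then obtain d where d: "norm d = 1" "has_side d D"
    using facet_supporting_frame[OF D] by metis
  obtain s0 s1 m h where side: "s0 < s1" "h > 0" "\<forall>x\<in>D. m \<le> left_normal d \<bullet> x"
    "frame_box d s0 s1 m (m + h) \<subseteq> D"
    using side_box[OF D(1) d] by metis
  obtain p u w c0 where bound: "w > 0" "C \<subseteq> frame_box d p (p + w) u (u + w)" "c0 \<in> C"
    "left_normal d \<bullet> c0 = u"
    using body_in_frame_box[OF C d(1)] by metis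
  define X where "X = min (s1 - s0) h"
  have X: "X > 0" "X \<le> s1 - s0" "X \<le> h" using side by (auto simp: X_def)
  have per: "perimeter C > 0" "perimeter D > 0"
    using perimeter_pos C D by auto
  \<comment> \<open>\<open>D\<close> has no points below height \<open>m\<close>, so points of
    \<open>D\<close> at that height are not interior.\<close>
  have base: "frame_point d \<sigma> m \<in> frontier D" if "\<sigma> \<in> {s0..s1}" for \<sigma>
  proof -
    have "frame_point d \<sigma> m \<in> D"
      using frame_point_in_box[OF d(1) that, of m m "m + h"] side by auto
    moreover have "frame_point d \<sigma> m \<notin> interior D"
    proof
      assume int: "frame_point d \<sigma> m \<in> interior D"
      then obtain e where e: "e > 0" "cball (frame_point d \<sigma> m) e \<subseteq> D"
        using mem_interior_cball by blast
      have "frame_point d \<sigma> (m - e) \<in> D"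
        using e d(1) by (intro subsetD[OF e(2)]) (simp add: frame_point_def dist_norm algebra_simps)
      then show False using side(3) e(1) by (auto simp: inner_frame_point[OF d(1)])
    qed
    ultimately show ?thesis using closure_subset by (auto simp: frontier_def)
  qed
  \<comment> \<open>The escape distances will sum to at most \<open>X\<close>, and the perimeters to
    at least \<open>X * perimeter C / w\<close> times \<open>log_ratio n / 24\<close>.\<close>
  define \<sigma>0 where "\<sigma>0 = X * perimeter C / (24 * w * (perimeter D + X))"
  have "\<sigma>0 > 0" using X per bound(1) by (simp add: \<sigma>0_def)
  moreover have "\<exists>S. packing S D \<and> card S = n \<and> (\<forall>K\<in>S. positive_homothet C K) \<and>
            (\<Sum>K\<in>S. perimeter K) \<ge> \<sigma>0 * (perimeter D + (\<Sum>K\<in>S. esc D K)) * log_ratio n"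
    if n: "n \<ge> 3" for n
  proof -
    obtain J :: "(nat \<times> nat) set" and a s t where J: "finite J" "card J = n"
      and unit: "\<And>x. x \<in> J \<Longrightarrow> 0 < a x \<and> 0 \<le> s x \<and> s x + a x \<le> 1 \<and> 0 \<le> t x \<and> t x + a x \<le> 1"
      and sep: "\<And>x y. x \<in> J \<Longrightarrow> y \<in> J \<Longrightarrow> x \<noteq> y \<Longrightarrow>
         s x + a x \<le> s y \<or> s y + a y \<le> s x \<or> t x + a x \<le> t y \<or> t y + a y \<le> t x"
      and sums: "(\<Sum>x\<in>J. t x) \<le> 1" "(\<Sum>x\<in>J. a x) \<ge> log_ratio n / 24"
      using square_packing[OF n] by metis
    \<comment> \<open>The scale turns the bounding square of side \<open>w\<close> into one of side
      \<open>X * a x\<close>; \<open>v x\<close> puts its lower left corner at the position of the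
      square \<open>x\<close> in the box of \<open>D\<close>.\<close>
    define \<mu> where "\<mu> x = X * a x / w" for x
    define v where "v x = frame_point d (s0 + X * s x - \<mu> x * p) (m + X * t x - \<mu> x * u)" for x
    define H where "H x = (\<lambda>c. \<mu> x *\<^sub>R c + v x) ` C" for x
    have \<mu>: "\<mu> x > 0" "\<mu> x * w = X * a x" if "x \<in> J" for x
      using unit[OF that] X bound(1) by (auto simp: \<mu>_def)
    have box: "H x \<subseteq> frame_box d (s0 + X * s x) (s0 + X * (s x + a x)) (m + X * t x) (m + X * (t x + a x))"
      if x: "x \<in> J" for x
    proof
      fix z assume "z \<in> H x"
      then obtain c where c: "c \<in> C" "z = \<mu> x *\<^sub>R c + v x" by (auto simp: H_def)
      have "d \<bullet> c \<in> {p..p + w}" "left_normal d \<bullet> c \<in> {u..u + w}"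
        using c(1) bound(2) by (auto simp: frame_box_def)
      then have "\<mu> x * p \<le> \<mu> x * (d \<bullet> c)" "\<mu> x * (d \<bullet> c) \<le> \<mu> x * (p + w)"
        "\<mu> x * u \<le> \<mu> x * (left_normal d \<bullet> c)" "\<mu> x * (left_normal d \<bullet> c) \<le> \<mu> x * (u + w)"
        using \<mu>(1)[OF x] by (auto intro: mult_left_mono)
      then show "z \<in> frame_box d (s0 + X * s x) (s0 + X * (s x + a x)) (m + X * t x) (m + X * (t x + a x))"
        using \<mu>(2)[OF x]
        by (simp add: c(2) frame_box_def v_def inner_right_distrib inner_frame_point[OF d(1)] distrib_left)
    qed
    have "frame_box d (s0 + X * s x) (s0 + X * (s x + a x)) (m + X * t x) (m + X * (t x + a x)) \<subseteq> D"
      if x: "x \<in> J" for x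
    proof -
      have "X * (s x + a x) \<le> X * 1" "X * (t x + a x) \<le> X * 1" "0 \<le> X * s x" "0 \<le> X * t x"
        using unit[OF x] X(1) by (intro mult_left_mono mult_nonneg_nonneg; auto)+
      then have "X * (s x + a x) \<le> s1 - s0" "X * (t x + a x) \<le> h" "0 \<le> X * s x" "0 \<le> X * t x"
        using X(2,3) by linarith+
      then have "frame_box d (s0 + X * s x) (s0 + X * (s x + a x)) (m + X * t x) (m + X * (t x + a x))
          \<subseteq> frame_box d s0 s1 m (m + h)"
        unfolding frame_box_def by auto
      then show ?thesis using side(4) by blast
    qed
    then have sub: "H x \<subseteq> D" if "x \<in> J" for x
      using box that by blast
    have body: "convex_body (H x)" if "x \<in> J" for x
      using convex_body_homothety[OF \<mu>(1)[OF that] C] by (simp add: H_def)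
    have disj: "interior (H x) \<inter> interior (H y) = {}" if "x \<in> J" "y \<in> J" "x \<noteq> y" for x y
    proof (rule ccontr)
      assume "interior (H x) \<inter> interior (H y) \<noteq> {}"
      then obtain z where z: "z \<in> interior (H x)" "z \<in> interior (H y)" by blast
      note str = interior_frame_box_strict[OF d(1) box[OF that(1)] z(1)]
        interior_frame_box_strict[OF d(1) box[OF that(2)] z(2)]
      have mono: "X * c \<le> X * c'" if "c \<le> c'" for c c'
        using X(1) that by simp
      from sep[OF that] show False
        using str mono by (elim disjE) (fastforce dest: mono)+
    qed
    \<comment> \<open>Equal images of distinct indices would have an interior disjoint from itself,
      hence empty.\<close>
    have inj: "inj_on H J"
    proof (rule inj_onI, rule ccontr)
      fix x y assume "x \<in> J" "y \<in> J" "H x = H y" "x \<noteq> y"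
      then show False using disj[of x y] body[of x] by (auto simp: convex_body_def)
    qed
    have esc_le: "esc D (H x) \<le> X * t x" if x: "x \<in> J" for x
    proof -
      \<comment> \<open>The lowest point of the homothet lies vertically above a frontier point of
        the side, at distance \<open>X * t x\<close>.\<close>
      let ?k = "\<mu> x *\<^sub>R c0 + v x"
      have k: "?k \<in> H x" unfolding H_def by (rule image_eqI[OF _ bound(3)]) simp
      have nk: "left_normal d \<bullet> ?k = m + X * t x"
        by (simp add: v_def inner_right_distrib inner_frame_point[OF d(1)] bound(4))
      have "X * (s x + a x) \<le> X * 1" "0 \<le> X * s x" "0 \<le> X * t x"
        using unit[OF x] X(1) by (intro mult_left_mono mult_nonneg_nonneg; auto)+
      moreover from this have "X * (s x + a x) \<le> s1 - s0"
        using X(2) by linarith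
      ultimately have "d \<bullet> ?k \<in> {s0..s1}"
        using subsetD[OF box[OF x] k] unfolding frame_box_def by auto
      then have "esc D (H x) \<le> dist ?k (frame_point d (d \<bullet> ?k) m)"
        unfolding esc_def by (intro setdist_le_dist k base)
      also have "?k = frame_point d (d \<bullet> ?k) (m + X * t x)"
        using frame_expansion[OF d(1), of ?k] nk by (simp add: frame_point_def)
      then have "dist ?k (frame_point d (d \<bullet> ?k) m)
          = dist (frame_point d (d \<bullet> ?k) (m + X * t x)) (frame_point d (d \<bullet> ?k) m)"
        by metis
      also have "\<dots> = X * t x"
        using d(1) \<open>0 \<le> X * t x\<close> by (simp add: frame_point_def dist_norm flip: scaleR_diff_left)
      finally show ?thesis .
    qed
    let ?E = "\<Sum>K\<in>H ` J. esc D K"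
    have "?E = (\<Sum>x\<in>J. esc D (H x))" by (simp add: sum.reindex[OF inj])
    also have "\<dots> \<le> (\<Sum>x\<in>J. X * t x)" using esc_le by (rule sum_mono)
    also have "\<dots> \<le> X * 1"
      using sums(1) X(1) by (simp flip: sum_distrib_left)
    finally have E: "?E \<le> X" by simp
    have "\<sigma>0 * (perimeter D + ?E) * log_ratio n \<le> \<sigma>0 * (perimeter D + X) * log_ratio n"
      using E \<open>\<sigma>0 > 0\<close> log_ratio_ge_1[OF n] by (intro mult_right_mono mult_left_mono) auto
    also have "\<dots> = X * perimeter C / w * (log_ratio n / 24)"
    proof -
      have cancel: "x / (24 * y * z) * z = x / y / 24" if "z \<noteq> 0" for x y z :: real
        using that by (simp add: field_simps)
      have "\<sigma>0 * (perimeter D + X) = X * perimeter C / w / 24"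
        unfolding \<sigma>0_def using X(1) per by (intro cancel) simp
      then show ?thesis by simp
    qed
    also have "\<dots> \<le> X * perimeter C / w * (\<Sum>x\<in>J. a x)"
      using sums(2) X(1) per bound(1) by (intro mult_left_mono) auto
    also have "\<dots> = (\<Sum>x\<in>J. \<mu> x * perimeter C)"
      by (simp add: \<mu>_def sum_distrib_left sum_divide_distrib algebra_simps)
    also have "\<dots> = (\<Sum>x\<in>J. perimeter (H x))"
      using \<mu>(1) by (intro sum.cong) (simp_all add: H_def perimeter_homothety)
    also have "\<dots> = (\<Sum>K\<in>H ` J. perimeter K)" by (simp add: sum.reindex[OF inj])
    finally have "\<sigma>0 * (perimeter D + ?E) * log_ratio n \<le> (\<Sum>K\<in>H ` J. perimeter K)" .
    moreover have "pairwise (\<lambda>K L. interior K \<inter> interior L = {}) (H ` J)"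
      by (rule pairwise_imageI) (use disj in blast)
    then have "packing (H ` J) D"
      using J(1) body sub by (auto simp: packing_def)
    moreover have "card (H ` J) = n" using card_image[OF inj] J(2) by simp
    moreover have "\<forall>K\<in>H ` J. positive_homothet C K"
      using \<mu>(1) unfolding positive_homothet_def H_def by blast
    ultimately show ?thesis by blast
  qed
  ultimately show ?thesis by blast
qed

theorem theorem3:
  fixes C D :: "plane set"
  assumes "convex_body C" and "convex_body D" and "polytope D" and "parallel_to D C"
  shows "(\<exists>\<rho>>0. \<forall>n\<ge>3. \<forall>S.
            packing S D \<and> card S = n \<and> (\<forall>K\<in>S. positive_homothet C K) \<longrightarrow>
            (\<Sum>K\<in>S. perimeter K) \<le>
              \<rho> * (perimeter D + (\<Sum>K\<in>S. esc D K)) * (log 2 (real n) / log 2 (log 2 (real n))))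
       \<and> (\<exists>\<sigma>>0. \<forall>n\<ge>3. \<exists>S.
            packing S D \<and> card S = n \<and> (\<forall>K\<in>S. positive_homothet C K) \<and>
            (\<Sum>K\<in>S. perimeter K) \<ge>
              \<sigma> * (perimeter D + (\<Sum>K\<in>S. esc D K)) * (log 2 (real n) / log 2 (log 2 (real n))))"
  using perimeter_upper_bound[OF assms] perimeter_lower_bound[OF assms(1-3)] by (rule conjI)

end
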